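(* Let $a>0$ and let $M=\mathbb{H}^2(-a^2)$. Then Leray–Hopf solutions to the Navier–Stokes equation $$\partial_t U^* - \Delta U^* + \overline{\nabla}_U U^* - 2\,\mathrm{Ric}(U^* ) + dP = 0,\qquad d^*U^*=0$$ on $M$ are non-unique; that is, there exist an initial datum $u_0$ (an $L^2$ one-form on $M$ with $d^*u_0=0$) and two Leray–Hopf solutions $U_1^*\neq U_2^*$ of this equation on $M$, both with initial datum $u_0$.
   Context: $\mathbb{H}^2(-a^2)$ is the complete simply connected 2-dimensional Riemannian manifold of constant sectional curvature $-a^2$. For a Riemannian manifold $(M,g)$: a vector field $U$ is identified with the one-form $U^*$ given by $U^*(Y)=g(U,Y)$; $\overline{\nabla}$ is the Levi-Civita connection on $TM$ and the induced one on $T^*M$, so $\overline{\nabla}_XY^*=(\overline{\nabla}_XY)^*$; $d^*$ is the formal adjoint of $d$; $-\Delta=dd^*+d^*d$ is the Hodge Laplacian; $\mathrm{Ric}$ acting on one-forms is the Ricci operator $\mathrm{Ric}(u^* )=\sum_{i,j}\eta^i\, g(R(e_i,e_j)e_j,u)$ ($e_i$ a local orthonormal frame, $\eta^i$ its dual frame, $R$ the curvature tensor with the sign convention for which $\mathrm{Ric}(\omega)=-(n-1)a^2\omega$ on the $n$-dimensional space form of curvature $-a^2$; in particular $\mathrm{Ric}(\omega)=-a^2\omega$ on $\mathbb{H}^2(-a^2)$). The deformation tensor of a one-form $\omega$ is $(\mathrm{Def}\,\omega)(Y,Z)=\tfrac12\{(\overline{\nabla}_Y\omega)(Z)+(\overline{\nabla}_Z\omega)(Y)\}$,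 and $\overline g(\cdot,\cdot)$ is the inner product on $T^*M\otimes T^*M$ induced by $g$, for which $\{\eta^i\otimes\eta^j\}$ is orthonormal whenever $\{\eta^i\}$ is an orthonormal coframe. A solution is a smooth time-dependent one-form $U^*$ on $(0,\infty)\times M$ satisfying the stated equations for some smooth scalar function $P$ (the pressure). It is a Leray–Hopf solution with initial datum $u_0\in L^2$ if moreover: (i) $U^*\in L^\infty(0,\infty;L^2(M))\cap L^2(0,\infty;H^1(M))$ (the $H^1$ norm being defined with $\overline{\nabla}$); (ii) for every $t\ge 0$ (with $U^*(0,\cdot)=u_0$), the global energy inequality holds: $\int_M|U^*|^2(t,x)+2\int_0^t\int_M\overline g(\mathrm{Def}\,U^*,\mathrm{Def}\,U^* )\,ds\le\int_M|u_0|^2$; (iii) $\lim_{t\to0^+}\|U^*(t,\cdot)-u_0\|_{L^2(M)}=0$. *)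

theory Defs
  imports "HOL-Analysis.Analysis"
begin

text \<open>
  Riemannian geometry in one global chart: the manifold is an open set \<open>M\<close> of \<open>real ^ 'n\<close> with
  Gram matrix \<open>g x\<close> at \<open>x\<close>.  A one-form is given by its components
  \<open>\<omega> x $ i = \<omega>(\<partial>\<^sub>i)\<close>, a covariant two-tensor by \<open>A x $ i $ j = A(\<partial>\<^sub>i, \<partial>\<^sub>j)\<close>.
  Values outside \<open>M\<close> are irrelevant throughout.
\<close>

section \<open>Smooth functions\<close>

primrec Ck_on :: "nat \<Rightarrow> 'a::real_normed_vector set \<Rightarrow> ('a \<Rightarrow> 'b::real_normed_vector) \<Rightarrow> bool" where
  "Ck_on 0 S f \<longleftrightarrow> continuous_on S f"
| "Ck_on (Suc k) S f \<longleftrightarrow>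
     (\<forall>x\<in>S. f differentiable (at x)) \<and> (\<forall>v. Ck_on k S (\<lambda>x. frechet_derivative f (at x) v))"

text \<open>Intended for open \<open>S\<close>.\<close>

definition smooth_on :: "'a::real_normed_vector set \<Rightarrow> ('a \<Rightarrow> 'b::real_normed_vector) \<Rightarrow> bool" where
  "smooth_on S f \<longleftrightarrow> (\<forall>k. Ck_on k S f)"

text \<open>Smooth functions (or tensor components) with compact support in \<open>M\<close>.\<close>

definition test_on :: "'a::real_normed_vector set \<Rightarrow> ('a \<Rightarrow> 'b::real_normed_vector) \<Rightarrow> bool" where
  "test_on M \<phi> \<longleftrightarrow> smooth_on M \<phi> \<and> (\<exists>K. compact K \<and> K \<subseteq> M \<and> (\<forall>x\<in>M - K. \<phi> x = 0))"

definition pd :: "'n::finite \<Rightarrow> (real ^ 'n \<Rightarrow> real) \<Rightarrow> real ^ 'n \<Rightarrow> real" where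
  "pd i f x = frechet_derivative f (at x) (axis i 1)"

section \<open>Metric, volume, inner products\<close>

type_synonym 'n metric = "real ^ 'n \<Rightarrow> real ^ 'n ^ 'n"
type_synonym 'n one_form = "real ^ 'n \<Rightarrow> real ^ 'n"
type_synonym 'n two_tensor = "real ^ 'n \<Rightarrow> real ^ 'n ^ 'n"

definition ginv :: "'n::finite metric \<Rightarrow> 'n metric" where
  "ginv g x = matrix_inv (g x)"

definition vol :: "(real ^ 'n::finite) set \<Rightarrow> 'n metric \<Rightarrow> (real ^ 'n) measure" where
  "vol M g = density (restrict_space lborel M) (\<lambda>x. ennreal (sqrt (det (g x))))"

text \<open>The vector field \<open>U\<close> with \<open>\<omega> = g(U, \<cdot>)\<close>.\<close>

definition sharp :: "'n::finite metric \<Rightarrow> 'n one_form \<Rightarrow> real ^ 'n \<Rightarrow> real ^ 'n" where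
  "sharp g \<omega> x = ginv g x *v \<omega> x"

definition inner1 :: "'n::finite metric \<Rightarrow> real ^ 'n \<Rightarrow> real ^ 'n \<Rightarrow> real ^ 'n \<Rightarrow> real" where
  "inner1 g x \<alpha> \<beta> = (\<Sum>i\<in>UNIV. \<Sum>j\<in>UNIV. ginv g x $ i $ j * \<alpha> $ i * \<beta> $ j)"

text \<open>For this product \<open>\<eta>\<^sup>i \<otimes> \<eta>\<^sup>j\<close> is orthonormal when \<open>\<eta>\<^sup>i\<close> is an orthonormal coframe.\<close>

definition inner2 :: "'n::finite metric \<Rightarrow> real ^ 'n \<Rightarrow> real ^ 'n ^ 'n \<Rightarrow> real ^ 'n ^ 'n \<Rightarrow> real" where
  "inner2 g x A B = (\<Sum>i\<in>UNIV. \<Sum>j\<in>UNIV. \<Sum>k\<in>UNIV. \<Sum>l\<in>UNIV.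
     ginv g x $ i $ k * ginv g x $ j $ l * A $ i $ j * B $ k $ l)"

text \<open>
  On two-forms (antisymmetric two-tensors) the inner product is the one for which
  \<open>\<eta>\<^sup>i \<and> \<eta>\<^sup>j = \<eta>\<^sup>i \<otimes> \<eta>\<^sup>j - \<eta>\<^sup>j \<otimes> \<eta>\<^sup>i\<close>, \<open>i < j\<close>, is orthonormal; hence the factor \<open>1/2\<close>.
\<close>

definition inner_2form ::
    "'n::finite metric \<Rightarrow> real ^ 'n \<Rightarrow> real ^ 'n ^ 'n \<Rightarrow> real ^ 'n ^ 'n \<Rightarrow> real" where
  "inner_2form g x A B = inner2 g x A B / 2"

section \<open>Exterior derivative, its formal adjoint, Hodge Laplacian\<close>

definition d0 :: "(real ^ 'n::finite \<Rightarrow> real) \<Rightarrow> 'n one_form" where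
  "d0 f x = (\<chi> i. pd i f x)"

definition d1 :: "'n::finite one_form \<Rightarrow> 'n two_tensor" where
  "d1 \<omega> x = (\<chi> i j. pd i (\<lambda>y. \<omega> y $ j) x - pd j (\<lambda>y. \<omega> y $ i) x)"

definition adjoint_d0 ::
    "(real ^ 'n::finite) set \<Rightarrow> 'n metric \<Rightarrow> 'n one_form \<Rightarrow> (real ^ 'n \<Rightarrow> real) \<Rightarrow> bool" where
  "adjoint_d0 M g \<omega> h \<longleftrightarrow> (\<forall>\<phi>. test_on M \<phi> \<longrightarrow>
     (LINT x|vol M g. h x * \<phi> x) = (LINT x|vol M g. inner1 g x (\<omega> x) (d0 \<phi> x)))"

definition adjoint_d1 ::
    "(real ^ 'n::finite) set \<Rightarrow> 'n metric \<Rightarrow> 'n two_tensor \<Rightarrow> 'n one_form \<Rightarrow> bool" where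
  "adjoint_d1 M g B \<beta> \<longleftrightarrow> (\<forall>\<phi>. test_on M \<phi> \<longrightarrow>
     (LINT x|vol M g. inner1 g x (\<beta> x) (\<phi> x)) = (LINT x|vol M g. inner_2form g x (B x) (d1 \<phi> x)))"

text \<open>
  \<open>d\<^sup>*\<close> on smooth one-forms and on smooth two-forms.  The smooth function or form singled out by the
  adjointness relation is unique on \<open>M\<close> only, so \<open>THE\<close> is applied to its value at each point of \<open>M\<close>.
\<close>

definition dstar1 ::
    "(real ^ 'n::finite) set \<Rightarrow> 'n metric \<Rightarrow> 'n one_form \<Rightarrow> real ^ 'n \<Rightarrow> real" where
  "dstar1 M g \<omega> x = (THE c. \<exists>h. smooth_on M h \<and> adjoint_d0 M g \<omega> h \<and> h x = c)"

definition dstar2 ::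
    "(real ^ 'n::finite) set \<Rightarrow> 'n metric \<Rightarrow> 'n two_tensor \<Rightarrow> 'n one_form" where
  "dstar2 M g B x = (THE c. \<exists>\<beta>. smooth_on M \<beta> \<and> adjoint_d1 M g B \<beta> \<and> \<beta> x = c)"

text \<open>The sign is \<open>-\<Delta> = d d\<^sup>* + d\<^sup>* d\<close>.\<close>

definition hodge_Laplacian :: "(real ^ 'n::finite) set \<Rightarrow> 'n metric \<Rightarrow> 'n one_form \<Rightarrow> 'n one_form" where
  "hodge_Laplacian M g \<omega> x = - (d0 (dstar1 M g \<omega>) x + dstar2 M g (d1 \<omega>) x)"

section \<open>Levi-Civita connection, deformation tensor, Ricci operator\<close>

text \<open>\<open>christoffel g k i j\<close> is \<open>\<Gamma>\<^sup>k\<^sub>i\<^sub>j\<close>, i.e. \<open>\<nabla>\<^bsub>\<partial>i\<^esub> \<partial>\<^sub>j = \<Sum>k. \<Gamma>\<^sup>k\<^sub>i\<^sub>j \<partial>\<^sub>k\<close>.\<close>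

definition christoffel ::
    "'n::finite metric \<Rightarrow> 'n \<Rightarrow> 'n \<Rightarrow> 'n \<Rightarrow> real ^ 'n \<Rightarrow> real" where
  "christoffel g k i j x = (\<Sum>l\<in>UNIV. ginv g x $ k $ l *
     (pd i (\<lambda>y. g y $ j $ l) x + pd j (\<lambda>y. g y $ i $ l) x - pd l (\<lambda>y. g y $ i $ j) x)) / 2"

text \<open>\<open>(\<nabla>\<omega>) $ i $ j = (\<nabla>\<^bsub>\<partial>i\<^esub> \<omega>)(\<partial>\<^sub>j)\<close>\<close>

definition nabla :: "'n::finite metric \<Rightarrow> 'n one_form \<Rightarrow> 'n two_tensor" where
  "nabla g \<omega> x =
     (\<chi> i j. pd i (\<lambda>y. \<omega> y $ j) x - (\<Sum>k\<in>UNIV. christoffel g k i j x * \<omega> x $ k))"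

definition nabla_along ::
    "'n::finite metric \<Rightarrow> (real ^ 'n \<Rightarrow> real ^ 'n) \<Rightarrow> 'n one_form \<Rightarrow> 'n one_form" where
  "nabla_along g X \<omega> x = (\<chi> j. \<Sum>i\<in>UNIV. X x $ i * nabla g \<omega> x $ i $ j)"

definition Def_tensor :: "'n::finite metric \<Rightarrow> 'n one_form \<Rightarrow> 'n two_tensor" where
  "Def_tensor g \<omega> x = (\<chi> i j. (nabla g \<omega> x $ i $ j + nabla g \<omega> x $ j $ i) / 2)"

text \<open>
  \<open>curvature g m l i j\<close> is the \<open>\<partial>\<^sub>m\<close>-component of \<open>R(\<partial>\<^sub>i, \<partial>\<^sub>j) \<partial>\<^sub>l\<close>, where
  \<open>R(X, Y) Z = \<nabla>\<^sub>X \<nabla>\<^sub>Y Z - \<nabla>\<^sub>Y \<nabla>\<^sub>X Z - \<nabla>\<^bsub>[X,Y]\<^esub> Z\<close>; with this sign \<open>g(R(e\<^sub>i, e\<^sub>j) e\<^sub>j, e\<^sub>i)\<close> is the sectional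
  curvature.
\<close>

definition curvature ::
    "'n::finite metric \<Rightarrow> 'n \<Rightarrow> 'n \<Rightarrow> 'n \<Rightarrow> 'n \<Rightarrow> real ^ 'n \<Rightarrow> real" where
  "curvature g m l i j x =
     pd i (christoffel g m j l) x - pd j (christoffel g m i l) x
     + (\<Sum>p\<in>UNIV. christoffel g m i p x * christoffel g p j l x
                 - christoffel g m j p x * christoffel g p i l x)"

text \<open>
  \<open>\<Sum>i j. \<eta>\<^sup>i g(R(e\<^sub>i, e\<^sub>j) e\<^sub>j, u)\<close>, with the trace over an orthonormal frame written in the coordinate
  frame as \<open>\<Sum>j. e\<^sub>j \<otimes> e\<^sub>j = \<Sum>j l. g\<^sup>j\<^sup>l \<partial>\<^sub>j \<otimes> \<partial>\<^sub>l\<close>, and \<open>g(\<partial>\<^sub>m, u) = \<omega>\<^sub>m\<close> for \<open>u = sharp g \<omega>\<close>.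
\<close>

definition Ric :: "'n::finite metric \<Rightarrow> 'n one_form \<Rightarrow> 'n one_form" where
  "Ric g \<omega> x =
     (\<chi> i. \<Sum>j\<in>UNIV. \<Sum>l\<in>UNIV. \<Sum>m\<in>UNIV. ginv g x $ j $ l * curvature g m l i j x * \<omega> x $ m)"

section \<open>Squared \<open>L\<^sup>2\<close> norms\<close>

definition L2sq1 :: "(real ^ 'n::finite) set \<Rightarrow> 'n metric \<Rightarrow> 'n one_form \<Rightarrow> ennreal" where
  "L2sq1 M g \<omega> = (\<integral>\<^sup>+x. ennreal (inner1 g x (\<omega> x) (\<omega> x)) \<partial>vol M g)"

definition L2sq2 :: "(real ^ 'n::finite) set \<Rightarrow> 'n metric \<Rightarrow> 'n two_tensor \<Rightarrow> ennreal" where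
  "L2sq2 M g A = (\<integral>\<^sup>+x. ennreal (inner2 g x (A x) (A x)) \<partial>vol M g)"

definition L2_form :: "(real ^ 'n::finite) set \<Rightarrow> 'n metric \<Rightarrow> 'n one_form \<Rightarrow> bool" where
  "L2_form M g \<omega> \<longleftrightarrow> \<omega> \<in> borel_measurable (vol M g) \<and> L2sq1 M g \<omega> < \<infinity>"

definition H1sq :: "(real ^ 'n::finite) set \<Rightarrow> 'n metric \<Rightarrow> 'n one_form \<Rightarrow> ennreal" where
  "H1sq M g \<omega> = L2sq1 M g \<omega> + L2sq2 M g (nabla g \<omega>)"

text \<open>\<open>d\<^sup>* \<omega> = 0\<close> for an \<open>L\<^sup>2\<close> one-form, which need not be differentiable.\<close>

definition weakly_coclosed :: "(real ^ 'n::finite) set \<Rightarrow> 'n metric \<Rightarrow> 'n one_form \<Rightarrow> bool" where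
  "weakly_coclosed M g \<omega> \<longleftrightarrow> adjoint_d0 M g \<omega> (\<lambda>_. 0)"

section \<open>The Navier--Stokes equation\<close>

definition NS_solution ::
    "(real ^ 'n::finite) set \<Rightarrow> 'n metric \<Rightarrow> (real \<Rightarrow> 'n one_form) \<Rightarrow> bool" where
  "NS_solution M g U \<longleftrightarrow>
     smooth_on ({0<..} \<times> M) (\<lambda>(t, x). U t x) \<and>
     (\<exists>P :: real \<Rightarrow> real ^ 'n \<Rightarrow> real.
        smooth_on ({0<..} \<times> M) (\<lambda>(t, x). P t x) \<and>
        (\<forall>t>0. \<forall>x\<in>M.
           vector_derivative (\<lambda>s. U s x) (at t) - hodge_Laplacian M g (U t) x
             + nabla_along g (sharp g (U t)) (U t) x - 2 *\<^sub>R Ric g (U t) x + d0 (P t) x = 0)) \<and>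
     (\<forall>t>0. \<forall>x\<in>M. dstar1 M g (U t) x = 0)"

text \<open>
  \<open>U\<close> is only meaningful for \<open>t > 0\<close>; \<open>U(0 := u0)\<close> is its extension to \<open>t = 0\<close>.
\<close>

definition Leray_Hopf ::
    "(real ^ 'n::finite) set \<Rightarrow> 'n metric \<Rightarrow> 'n one_form \<Rightarrow> (real \<Rightarrow> 'n one_form) \<Rightarrow> bool" where
  "Leray_Hopf M g u0 U \<longleftrightarrow>
     NS_solution M g U \<and>
     (\<exists>C::real. AE t in lborel. t > 0 \<longrightarrow> L2sq1 M g (U t) \<le> ennreal C) \<and>
     (\<integral>\<^sup>+t\<in>{0<..}. H1sq M g (U t) \<partial>lborel) < \<infinity> \<and>
     (\<forall>t\<ge>0. L2sq1 M g ((U(0 := u0)) t)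
              + 2 * (\<integral>\<^sup>+s\<in>{0<..<t}. L2sq2 M g (Def_tensor g (U s)) \<partial>lborel)
            \<le> L2sq1 M g u0) \<and>
     ((\<lambda>t. L2sq1 M g (\<lambda>x. U t x - u0 x)) \<longlongrightarrow> 0) (at_right 0)"

section \<open>The hyperbolic plane\<close>

text \<open>
  Poincare disk model of the hyperbolic plane of curvature \<open>-a\<^sup>2\<close>: the unit disk with metric
  \<open>4 |dx|\<^sup>2 / (a\<^sup>2 (1 - |x|\<^sup>2)\<^sup>2)\<close>.
\<close>

definition hyp_disk :: "(real ^ 2) set" where
  "hyp_disk = ball 0 1"

definition hyp_metric :: "real \<Rightarrow> 2 metric" where
  "hyp_metric a x = mat (4 / (a\<^sup>2 * (1 - (norm x)\<^sup>2)\<^sup>2))"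

end

theory Submission
  imports Defs
begin

text \<open>
  Unlike Euclidean space, the hyperbolic plane carries nonzero harmonic one-forms of finite energy.  In
  two dimensions both the Hodge star on one-forms and the \<open>L\<^sup>2\<close> norm of a one-form are conformally
  invariant, so in the disk model the differential \<open>v\<close> of a linear function, a form with constant
  coefficients, is closed, coclosed and square integrable, exactly as on the Euclidean unit disk.

  For such a \<open>v\<close> and any smooth scalar function \<open>\<psi>\<close> of time, \<open>\<psi>(t) v\<close> solves the Navier--Stokes equation.
  Indeed the Hodge Laplacian of \<open>v\<close> vanishes, \<open>\<nabla>\<^sub>v v = d(|v|\<^sup>2)/2\<close> because \<open>v\<close> is closed, and
  \<open>Ric v = - a\<^sup>2 v\<close> by the curvature; as \<open>v\<close> itself is exact, every term of the equation is the
  differential of a function and the pressure can absorb all of them.  Hence the equation does not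
  determine \<open>\<psi>\<close>, and only the energy inequality restricts it.  For \<open>\<psi>(t) = exp (- c t)\<close> the squared norm
  decays at rate \<open>2 c\<close>, while \<open>\<parallel>Def v\<parallel>\<^sup>2 = \<parallel>\<nabla>v\<parallel>\<^sup>2 \<le> 2 a\<^sup>2 \<parallel>v\<parallel>\<^sup>2\<close>, so the inequality
  holds for every \<open>c \<ge> 2 a\<^sup>2\<close> (lemma \<open>Leray_Hopf_decay\<close>).  Two such rates give two solutions with the same
  initial datum \<open>v\<close>.  The bound on \<open>\<parallel>\<nabla>v\<parallel>\<close> is read off pointwise in the chart and is twice the exact
  value \<open>a\<^sup>2 \<parallel>v\<parallel>\<^sup>2\<close> that Bochner's formula gives; a larger decay rate makes up for the factor.

  The formal adjoints of \<open>d\<close> are defined by duality with test functions, so computing them needs two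
  facts: the integral of a derivative of a test function vanishes
  (\<open>integral_derivative_test_function\<close>), which shows that \<open>0\<close> is a candidate for \<open>d\<^sup>* v\<close>, and a
  continuous function orthogonal to all test functions vanishes (\<open>eq_0_if_test_integrals_0\<close>), which
  shows that there is no other candidate.  The second one needs a smooth bump function.  Connection and
  curvature are computed in coordinates.
\<close>

section \<open>Calculus of smooth functions\<close>

lemma Ck_on_cong:
  assumes "open S" "\<And>x. x \<in> S \<Longrightarrow> f x = g x" "Ck_on k S f"
  shows "Ck_on k S g"
  using assms(2,3)
proof (induction k arbitrary: f g)
  case 0
  then show ?case
    using continuous_on_cong[of S S f g] by simp
next
  case (Suc k)
  have *: "(g has_derivative frechet_derivative f (at x)) (at x)" if "x \<in> S" for x
  proof (rule has_derivative_transform_within_open[OF _ \<open>open S\<close> that])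
    show "(f has_derivative frechet_derivative f (at x)) (at x)"
      using Suc.prems(2) that frechet_derivative_works by auto
  qed (use Suc.prems(1) in auto)
  have "Ck_on k S (\<lambda>x. frechet_derivative g (at x) v)" for v
    by (rule Suc.IH[of "\<lambda>x. frechet_derivative f (at x) v"])
       (use frechet_derivative_at[OF *] Suc.prems(2) in auto)
  then show ?case
    using * by (auto simp: differentiable_def)
qed

text \<open>
  Recursion on \<open>frechet_derivative\<close> itself is awkward, since it agrees with a given formula for the
  derivative on \<open>S\<close> only; openness of \<open>S\<close> makes this agreement sufficient at every order.
\<close>
lemma Ck_on_SucI:
  assumes "open S" "\<And>x. x \<in> S \<Longrightarrow> (f has_derivative f' x) (at x)"
    and "\<And>v. Ck_on k S (\<lambda>x. f' x v)"
  shows "Ck_on (Suc k) S f"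
proof -
  have "Ck_on k S (\<lambda>x. frechet_derivative f (at x) v)" for v
    by (rule Ck_on_cong[OF assms(1) _ assms(3)[of v]])
       (use frechet_derivative_at[OF assms(2)] in auto)
  then show ?thesis
    using assms(2) by (auto simp: differentiable_def)
qed

lemma Ck_on_Suc_has_derivative:
  assumes "Ck_on (Suc k) S f" "x \<in> S"
  shows "(f has_derivative frechet_derivative f (at x)) (at x)"
  using assms frechet_derivative_works by auto

lemma Ck_on_Suc_imp_Ck_on: "Ck_on (Suc k) S f \<Longrightarrow> Ck_on k S f"
proof (induction k arbitrary: f)
  case 0
  then show ?case
    by (auto intro!: continuous_at_imp_continuous_on differentiable_imp_continuous_within)
next
  case (Suc k)
  then show ?case
    by (metis Ck_on.simps(2))
qed

lemma smooth_on_imp_continuous_on: "smooth_on S f \<Longrightarrow> continuous_on S f"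
  unfolding smooth_on_def by (metis Ck_on.simps(1))

lemma smooth_on_has_derivative:
  "smooth_on S f \<Longrightarrow> x \<in> S \<Longrightarrow> (f has_derivative frechet_derivative f (at x)) (at x)"
  unfolding smooth_on_def using Ck_on_Suc_has_derivative by blast

lemma smooth_on_frechet_derivative:
  "smooth_on S f \<Longrightarrow> smooth_on S (\<lambda>x. frechet_derivative f (at x) v)"
  unfolding smooth_on_def by (metis Ck_on.simps(2))

lemma Ck_on_const: "Ck_on k S (\<lambda>x. c)"
proof (induction k arbitrary: c)
  case (Suc k)
  then show ?case by (simp add: frechet_derivative_const)
qed simp

lemma smooth_on_const: "smooth_on S (\<lambda>x. c)"
  by (simp add: smooth_on_def Ck_on_const)

lemma smooth_on_bounded_linear:
  assumes "open S" "bounded_linear f"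
  shows "smooth_on S f"
  unfolding smooth_on_def
proof
  fix k
  show "Ck_on k S f"
  proof (cases k)
    case 0
    then show ?thesis
      using assms(2) by (simp add: linear_continuous_on)
  next
    case (Suc m)
    have "Ck_on (Suc m) S f"
      by (rule Ck_on_SucI[OF assms(1), where f' = "\<lambda>_. f"])
         (auto simp: Ck_on_const intro: bounded_linear_imp_has_derivative assms)
    then show ?thesis
      using Suc by simp
  qed
qed

lemma Ck_on_add:
  assumes "open S" "Ck_on k S f" "Ck_on k S g"
  shows "Ck_on k S (\<lambda>x. f x + g x)"
  using assms(2,3)
proof (induction k arbitrary: f g)
  case 0
  then show ?case by (auto intro: continuous_on_add)
next
  case (Suc k)
  show ?case
    by (rule Ck_on_SucI[OF assms(1) has_derivative_add])
       (use Suc in \<open>auto intro: Ck_on_Suc_has_derivative\<close>)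
qed

lemma smooth_on_add:
  "open S \<Longrightarrow> smooth_on S f \<Longrightarrow> smooth_on S g \<Longrightarrow> smooth_on S (\<lambda>x. f x + g x)"
  by (simp add: smooth_on_def Ck_on_add)

lemma Ck_on_bilinear:
  assumes "bounded_bilinear B" "open S" "Ck_on k S f" "Ck_on k S g"
  shows "Ck_on k S (\<lambda>x. B (f x) (g x))"
  using assms(3,4)
proof (induction k arbitrary: f g)
  case 0
  then show ?case by (auto intro: bounded_bilinear.continuous_on[OF assms(1)])
next
  case (Suc k)
  show ?case
  proof (rule Ck_on_SucI[OF assms(2) bounded_bilinear.FDERIV[OF assms(1)]])
    show "Ck_on k S (\<lambda>x. B (f x) (frechet_derivative g (at x) v)
            + B (frechet_derivative f (at x) v) (g x))" for v
      using Suc.prems Suc.prems[THEN Ck_on_Suc_imp_Ck_on]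
      by (intro Ck_on_add assms(2) Suc.IH) (simp_all del: Ck_on.simps add: Ck_on.simps(2))
  qed (use Suc.prems in \<open>auto intro: Ck_on_Suc_has_derivative\<close>)
qed

lemma smooth_on_bilinear:
  assumes "bounded_bilinear B" "open S" "smooth_on S f" "smooth_on S g"
  shows "smooth_on S (\<lambda>x. B (f x) (g x))"
  using assms by (simp add: smooth_on_def Ck_on_bilinear)

lemmas smooth_on_mult = smooth_on_bilinear[OF bounded_bilinear_mult]
lemmas smooth_on_scaleR = smooth_on_bilinear[OF bounded_bilinear_scaleR]
lemmas smooth_on_inner = smooth_on_bilinear[OF bounded_bilinear_inner]

lemma Ck_on_compose_real:
  fixes f :: "real \<Rightarrow> real" and u :: "'a::real_normed_vector \<Rightarrow> real"
  assumes "open S" "Ck_on k UNIV f" "Ck_on k S u"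
  shows "Ck_on k S (\<lambda>x. f (u x))"
  using assms(2,3)
proof (induction k arbitrary: f)
  case 0
  then show ?case by (auto intro: continuous_on_compose2)
next
  case (Suc k)
  show ?case
  proof (rule Ck_on_SucI[OF assms(1)])
    fix x assume "x \<in> S"
    have fu: "((\<lambda>x. f (u x)) has_derivative
            (\<lambda>v. frechet_derivative f (at (u x)) (frechet_derivative u (at x) v))) (at x)"
      by (rule has_derivative_compose) (use Suc.prems \<open>x \<in> S\<close> in \<open>auto intro: Ck_on_Suc_has_derivative\<close>)
    have D: "frechet_derivative f (at (u x)) w = frechet_derivative f (at (u x)) 1 * w" for w
    proof -
      have "linear (frechet_derivative f (at (u x)))"
        using Suc.prems(1) by (intro linear_frechet_derivative) auto
      from linear_cmul[OF this, of w 1] show ?thesis by simp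
    qed
    show "((\<lambda>x. f (u x)) has_derivative
            (\<lambda>v. frechet_derivative f (at (u x)) 1 * frechet_derivative u (at x) v)) (at x)"
      by (rule has_derivative_eq_rhs[OF fu]) (rule ext, rule D)
  next
    show "Ck_on k S (\<lambda>x. frechet_derivative f (at (u x)) 1 * frechet_derivative u (at x) v)" for v
    proof (rule Ck_on_bilinear[OF bounded_bilinear_mult assms(1)])
      show "Ck_on k S (\<lambda>x. frechet_derivative f (at (u x)) 1)"
        by (rule Suc.IH[of "\<lambda>y. frechet_derivative f (at y) 1"])
           (use Suc.prems(1) Ck_on_Suc_imp_Ck_on[OF Suc.prems(2)] in simp_all)
      show "Ck_on k S (\<lambda>x. frechet_derivative u (at x) v)"
        using Suc.prems(2) by simp
    qed
  qed
qed

lemma smooth_on_compose_real: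
  fixes f :: "real \<Rightarrow> real"
  assumes "open S" "smooth_on UNIV f" "smooth_on S u"
  shows "smooth_on S (\<lambda>x. f (u x))"
  using assms by (simp add: smooth_on_def Ck_on_compose_real)

lemma smooth_on_exp: "smooth_on UNIV (exp :: real \<Rightarrow> real)"
  unfolding smooth_on_def
proof
  show "Ck_on k UNIV (exp :: real \<Rightarrow> real)" for k
  proof (induction k)
    case 0
    show ?case by (simp add: continuous_on_exp)
  next
    case (Suc k)
    show ?case
      by (rule Ck_on_SucI[where f' = "\<lambda>x v. exp x * v"])
         (auto intro!: Ck_on_bilinear[OF bounded_bilinear_mult] Suc Ck_on_const
            has_derivative_eq_rhs[OF DERIV_exp[unfolded has_field_derivative_def]])
  qed
qed

section \<open>Smooth bumps\<close>

text \<open>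
  The factor \<open>1 / s ^ n\<close> makes the family closed under differentiation up to linear combinations, so all
  members are shown to be smooth simultaneously; only \<open>flat 0\<close>, that is \<open>exp (- 1 / s)\<close> extended
  by zero, occurs in the bump functions.
\<close>
definition flat :: "nat \<Rightarrow> real \<Rightarrow> real" where
  "flat n s = (if s \<le> 0 then 0 else exp (- 1 / s) / s ^ n)"

lemma tendsto_flat_0: "(flat n \<longlongrightarrow> 0) (at 0)"
proof -
  have "((\<lambda>y::real. y ^ n / exp y) \<longlongrightarrow> 0) at_top"
    by (rule tendsto_power_div_exp_0)
  then have "((\<lambda>s::real. inverse s ^ n / exp (inverse s)) \<longlongrightarrow> 0) (at_right 0)"
    by (rule filterlim_compose) (rule filterlim_inverse_at_top_right)
  then have "(flat n \<longlongrightarrow> 0) (at_right 0)"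
    by (rule Lim_transform_eventually)
       (auto simp: flat_def eventually_at_right_field exp_minus field_simps intro!: exI[of _ 1])
  moreover have "(flat n \<longlongrightarrow> 0) (at_left 0)"
    by (rule tendsto_eventually) (auto simp: flat_def eventually_at_left_field intro!: exI[of _ "-1"])
  ultimately show ?thesis
    by (simp add: filterlim_split_at)
qed

lemma flat_has_real_derivative:
  "(flat n has_real_derivative flat (n + 2) s - real n * flat (n + 1) s) (at s)"
proof -
  consider "s < 0" | "s = 0" | "s > 0" by linarith
  then show ?thesis
  proof cases
    case 1
    have "(flat n has_real_derivative 0) (at s)"
      by (rule has_field_derivative_transform_within_open[OF DERIV_const[of 0], where S = "{..<0}"])
         (use 1 in \<open>auto simp: flat_def\<close>)
    then show ?thesis using 1 by (simp add: flat_def)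
  next
    case 2
    \<comment> \<open>The difference quotient of \<open>flat n\<close> at \<open>0\<close> is \<open>flat (Suc n)\<close>.\<close>
    have "((\<lambda>h. (flat n (0 + h) - flat n 0) / h) \<longlongrightarrow> 0) (at 0)"
      using tendsto_flat_0[of "Suc n"]
      by (rule Lim_transform_eventually) (auto simp: flat_def eventually_at_filter)
    then have "(flat n has_real_derivative 0) (at 0)"
      by (simp add: DERIV_def)
    then show ?thesis using 2 by (simp add: flat_def)
  next
    case 3
    have "real n * s ^ (n - 1) = n * s ^ n / s"
      using 3 by (cases n) auto
    then have pow: "((\<lambda>s. s ^ n) has_real_derivative n * s ^ n / s) (at s)"
      using DERIV_pow[of n s UNIV] by (simp only: One_nat_def)
    have exp: "((\<lambda>s. exp (- 1 / s)) has_real_derivative exp (- 1 / s) / s\<^sup>2) (at s)"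
      using 3 by (auto intro!: derivative_eq_intros simp: power2_eq_square)
    have "(exp (- 1 / s) / s\<^sup>2 * s ^ n - exp (- 1 / s) * (n * s ^ n / s)) / (s ^ n * s ^ n)
        = flat (n + 2) s - real n * flat (n + 1) s"
      using 3 by (simp add: flat_def power_add divide_simps) (simp add: algebra_simps power2_eq_square)
    with DERIV_divide[OF exp pow] have "((\<lambda>s. exp (- 1 / s) / s ^ n) has_real_derivative
        flat (n + 2) s - real n * flat (n + 1) s) (at s)"
      using 3 by simp
    then show ?thesis
      by (rule has_field_derivative_transform_within_open[where S = "{0<..}"])
         (use 3 in \<open>auto simp: flat_def\<close>)
  qed
qed

lemma smooth_on_flat: "smooth_on UNIV (flat n)"
  unfolding smooth_on_def
proof
  show "Ck_on k UNIV (flat n)" for k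
  proof (induction k arbitrary: n)
    case 0
    show ?case
      using flat_has_real_derivative by (auto intro!: continuous_at_imp_continuous_on DERIV_isCont)
  next
    case (Suc k)
    have "Ck_on k UNIV (\<lambda>s. (flat (n + 2) s + - real n * flat (n + 1) s) * v)" for v
      by (intro Ck_on_add Ck_on_bilinear[OF bounded_bilinear_mult] Suc Ck_on_const open_UNIV)
    then show ?case
      using flat_has_real_derivative[of n]
      by (intro Ck_on_SucI[where f' = "\<lambda>s v. (flat (n + 2) s + - real n * flat (n + 1) s) * v"])
         (auto simp: has_field_derivative_def)
  qed
qed

definition bump :: "'a::real_inner \<Rightarrow> real \<Rightarrow> 'a \<Rightarrow> real" where
  "bump c r x = flat 0 (r\<^sup>2 - (norm (x - c))\<^sup>2)"

lemma bump_nonneg: "0 \<le> bump c r x"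
  by (simp add: bump_def flat_def)

lemma bump_pos: "x \<in> ball c r \<Longrightarrow> 0 < bump c r x"
  by (auto simp: bump_def flat_def dist_norm norm_minus_commute not_le intro!: power_strict_mono)

lemma bump_eq_0: "0 < r \<Longrightarrow> x \<notin> cball c r \<Longrightarrow> bump c r x = 0"
  by (auto simp: bump_def flat_def dist_norm norm_minus_commute intro!: power_mono)

lemma smooth_on_bump:
  fixes c :: "'a::real_inner"
  assumes "open S"
  shows "smooth_on S (bump c r)"
proof -
  have "smooth_on S (\<lambda>x. (x + - c) \<bullet> (x + - c))"
    by (intro smooth_on_inner smooth_on_add smooth_on_const assms smooth_on_bounded_linear
        bounded_linear_ident)
  then have "smooth_on S (\<lambda>x. r\<^sup>2 + (-1) * ((x + - c) \<bullet> (x + - c)))"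
    by (intro smooth_on_mult smooth_on_add smooth_on_const assms)
  from smooth_on_compose_real[OF assms smooth_on_flat this, of 0]
  show ?thesis
    by (simp add: bump_def[abs_def] power2_norm_eq_inner)
qed

lemma test_on_bump:
  fixes c :: "'a::euclidean_space"
  assumes "open M" "0 < r" "cball c r \<subseteq> M"
  shows "test_on M (\<lambda>x. bump c r x *\<^sub>R v)"
  unfolding test_on_def
proof
  show "smooth_on M (\<lambda>x. bump c r x *\<^sub>R v)"
    by (intro smooth_on_scaleR smooth_on_bump smooth_on_const assms)
  show "\<exists>K. compact K \<and> K \<subseteq> M \<and> (\<forall>x\<in>M - K. bump c r x *\<^sub>R v = 0)"
    using assms by (intro exI[of _ "cball c r"]) (auto simp: bump_eq_0)
qed

section \<open>Test functions\<close>

text \<open>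
  The fundamental lemma of the calculus of variations: near a point where \<open>f\<close> does not vanish it has a
  constant sign, so its integral against a bump concentrated there is not zero.
\<close>
lemma eq_0_if_test_integrals_0:
  fixes f :: "'a::euclidean_space \<Rightarrow> real"
  assumes M: "open M" and f: "continuous_on M f"
    and int: "\<And>\<phi>::'a \<Rightarrow> real. test_on M \<phi> \<Longrightarrow> (LINT x:M|lborel. f x * \<phi> x) = 0"
    and "c \<in> M"
  shows "f c = 0"
proof (rule ccontr)
  assume "f c \<noteq> 0"
  define s where "s = sgn (f c)"
  have "continuous_on M (\<lambda>x. s * f x)"
    by (intro continuous_intros f)
  then have "open (M \<inter> (\<lambda>x. s * f x) -` {0<..})"
    by (rule continuous_open_preimage) (auto simp: M)
  moreover have "c \<in> M \<inter> (\<lambda>x. s * f x) -` {0<..}"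
    using \<open>f c \<noteq> 0\<close> \<open>c \<in> M\<close> by (auto simp: s_def sgn_if)
  ultimately obtain r where r: "0 < r" "cball c r \<subseteq> M \<inter> (\<lambda>x. s * f x) -` {0<..}"
    by (meson open_contains_cball)
  have bump_cont: "continuous_on UNIV (bump c r)"
    by (rule smooth_on_imp_continuous_on[OF smooth_on_bump[OF open_UNIV]])
  let ?h = "\<lambda>x. indicator (cball c r) x *\<^sub>R (s * f x * bump c r x)"
  have "set_integrable lborel (cball c r) (\<lambda>x. s * f x * bump c r x)"
    unfolding set_integrable_def
    by (rule borel_integrable_compact)
       (use r in \<open>auto intro!: continuous_intros continuous_on_subset[OF f]
          continuous_on_subset[OF bump_cont]\<close>)
  then have integrable: "integrable lborel ?h"
    by (simp add: set_integrable_def)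
  have "(LINT x|lborel. ?h x) = (LINT x:M|lborel. s * (f x * bump c r x))"
    unfolding set_lebesgue_integral_def
    by (rule Bochner_Integration.integral_cong) (use r in \<open>auto simp: indicator_def bump_eq_0\<close>)
  also have "\<dots> = s * (LINT x:M|lborel. f x * bump c r x)"
    by simp
  also have "\<dots> = 0"
    using int[of "\<lambda>x. bump c r x *\<^sub>R 1"] test_on_bump[OF M r(1), of c "1::real"] r(2) by auto
  finally have "(LINT x|lborel. ?h x) = 0" .
  moreover have "0 \<le> ?h x" for x
  proof (cases "x \<in> cball c r")
    case True
    then have "0 < s * f x" using r(2) by auto
    then show ?thesis using bump_nonneg[of c r x] by simp
  qed simp
  ultimately have "AE x in lborel. ?h x = 0"
    using integral_nonneg_eq_0_iff_AE[OF integrable AE_I2] by blast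
  then have "AE x in lborel. x \<notin> ball c r"
  proof eventually_elim
    case (elim x)
    show ?case
    proof
      assume x: "x \<in> ball c r"
      then have "0 < s * f x" using r(2) by (auto simp: subset_eq)
      then show False
        using elim bump_pos[OF x] x by (auto simp: indicator_def)
    qed
  qed
  then have "emeasure lborel (ball c r) = 0"
    by (subst (asm) AE_iff_measurable[of "ball c r"]) auto
  then have "measure lborel (ball c r) = 0"
    by (simp add: measure_def)
  then show False
    using r(1) by simp
qed

text \<open>
  By translation invariance of Lebesgue measure every difference quotient of \<open>f\<close> in direction \<open>v\<close> has
  integral zero.  The quotients tend to the derivative; by the mean value theorem they are bounded,
  and for steps at most \<open>1\<close> they are supported in a common ball, so dominated convergence applies.
\<close>
lemma integral_directional_derivative_eq_0:
  fixes f :: "'a::euclidean_space \<Rightarrow> real"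
  assumes f': "\<And>x. (f has_derivative f' x) (at x)"
    and cont: "continuous_on UNIV (\<lambda>x. f' x v)"
    and K: "compact K" "\<And>x. x \<notin> K \<Longrightarrow> f x = 0" "\<And>x. x \<notin> K \<Longrightarrow> f' x v = 0"
  shows "(LINT x|lborel. f' x v) = 0"
proof -
  have f_cont: "continuous_on UNIV f"
    by (meson UNIV_I continuous_at_imp_continuous_on f' has_derivative_continuous)
  have "bounded ((\<lambda>x. f' x v) ` K)"
    using K(1) continuous_on_subset[OF cont] by (intro compact_imp_bounded compact_continuous_image) auto
  then obtain C0 where C0: "\<And>x. x \<in> K \<Longrightarrow> \<bar>f' x v\<bar> \<le> C0"
    by (auto simp: bounded_iff)
  define C where "C = max C0 0"
  have C: "\<bar>f' x v\<bar> \<le> C" for x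
    using C0[of x] K(3)[of x] by (cases "x \<in> K") (auto simp: C_def)
  obtain R where R: "\<And>x. x \<in> K \<Longrightarrow> norm x \<le> R"
    using compact_imp_bounded[OF K(1)] by (auto simp: bounded_iff)
  define h where "h n = inverse (real (Suc n))" for n
  have h: "0 < h n" "h n \<le> 1" for n
    by (auto simp: h_def field_simps)
  have h_lim: "h \<longlonglongrightarrow> 0"
    unfolding h_def by (rule LIMSEQ_inverse_real_of_nat)
  define q where "q n x = (f (x + h n *\<^sub>R v) - f x) / h n" for n x
  have path: "((\<lambda>t. f (x + t *\<^sub>R v)) has_real_derivative f' (x + t *\<^sub>R v) v) (at t)" for x t
  proof -
    have "((\<lambda>t. f (x + t *\<^sub>R v)) has_derivative (\<lambda>s. f' (x + t *\<^sub>R v) (s *\<^sub>R v))) (at t)"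
      by (rule has_derivative_compose[OF _ f']) (auto intro!: derivative_eq_intros)
    moreover have "f' y (s *\<^sub>R v) = f' y v * s" for y s
      using linear_cmul[OF has_derivative_linear[OF f'[of y]], of s v] by simp
    ultimately show ?thesis
      by (simp add: has_field_derivative_def)
  qed
  have q_lim: "(\<lambda>n. q n x) \<longlonglongrightarrow> f' x v" for x
  proof -
    have "((\<lambda>s. (f (x + s *\<^sub>R v) - f x) / s) \<longlongrightarrow> f' x v) (at 0)"
      using path[of x 0] by (simp add: DERIV_def)
    moreover have "filterlim h (at 0) sequentially"
      using h_lim h(1) by (auto simp: filterlim_at intro!: always_eventually less_imp_neq[symmetric])
    ultimately show ?thesis
      unfolding q_def by (rule filterlim_compose)
  qed
  have q_bound: "\<bar>q n x\<bar> \<le> C * indicator (cball 0 (R + norm v)) x" for n x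
  proof (cases "x \<in> cball 0 (R + norm v)")
    case True
    obtain z where "f (x + h n *\<^sub>R v) - f (x + 0 *\<^sub>R v) = (h n - 0) * f' (x + z *\<^sub>R v) v"
      using MVT2[OF h(1)[of n], of "\<lambda>t. f (x + t *\<^sub>R v)" "\<lambda>t. f' (x + t *\<^sub>R v) v"] path by blast
    then have "q n x = f' (x + z *\<^sub>R v) v"
      using h(1)[of n] by (simp add: q_def)
    then show ?thesis using True C by simp
  next
    case False
    have "norm (h n *\<^sub>R v) \<le> norm v"
      using h[of n] by (auto simp: mult_left_le_one_le)
    then have "x \<notin> K" "x + h n *\<^sub>R v \<notin> K"
      using False R[of x] R[of "x + h n *\<^sub>R v"] norm_triangle_ineq4[of "x + h n *\<^sub>R v" "h n *\<^sub>R v"]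
        norm_ge_zero[of v]
      by (auto simp del: norm_ge_zero)
    then show ?thesis using False by (simp add: q_def K(2))
  qed
  have f_int: "integrable lborel f"
  proof -
    have "integrable lborel (\<lambda>x. indicator K x *\<^sub>R f x)"
      by (rule borel_integrable_compact[OF K(1) continuous_on_subset[OF f_cont]]) auto
    moreover have "(\<lambda>x. indicator K x *\<^sub>R f x) = f"
      using K(2) by (fastforce simp: indicator_def)
    ultimately show ?thesis by simp
  qed
  have f_meas: "f \<in> borel_measurable borel"
    using f_cont by (rule borel_measurable_continuous_onI)
  have f_shift: "integrable lborel (\<lambda>x. f (x + w))" "(LINT x|lborel. f (x + w)) = (LINT x|lborel. f x)" for w
    using f_int integrable_distr_eq[of "(+) w" lborel borel f] integral_distr[of "(+) w" lborel borel f]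
    by (simp_all add: lborel_distr_plus f_meas add.commute)
  have "(\<lambda>n. LINT x|lborel. q n x) \<longlonglongrightarrow> (LINT x|lborel. f' x v)"
  proof (rule integral_dominated_convergence)
    show "integrable lborel (\<lambda>x. C * indicator (cball 0 (R + norm v)) x)"
      by (auto intro!: integrable_real_indicator simp: emeasure_bounded_finite[unfolded infinity_ennreal_def])
    show "AE x in lborel. (\<lambda>n. q n x) \<longlonglongrightarrow> f' x v"
      by (simp add: q_lim)
    show "AE x in lborel. norm (q n x) \<le> C * indicator (cball 0 (R + norm v)) x" for n
      using q_bound by simp
    show "(\<lambda>x. f' x v) \<in> borel_measurable lborel"
      using borel_measurable_continuous_onI[OF cont] by simp
    show "q n \<in> borel_measurable lborel" for n
      unfolding q_def using f_shift(1)[of "h n *\<^sub>R v"] f_int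
      by (intro borel_measurable_divide borel_measurable_diff borel_measurable_integrable) auto
  qed
  moreover have "(LINT x|lborel. q n x) = 0" for n
    unfolding q_def using f_shift[of "h n *\<^sub>R v"] f_int by simp
  ultimately show ?thesis
    by (simp add: LIMSEQ_const_iff)
qed

text \<open>
  A test function is unconstrained outside \<open>M\<close>, and so is its derivative; the proof passes to the
  extension by zero, which is differentiable everywhere since \<open>M\<close> and the complement of the support
  cover the space.
\<close>
lemma integral_derivative_test_function:
  fixes \<phi> :: "'a::euclidean_space \<Rightarrow> real"
  assumes M: "open M" and \<phi>: "test_on M \<phi>"
  shows "(LINT x:M|lborel. frechet_derivative \<phi> (at x) v) = 0"
proof -
  obtain K where smooth: "smooth_on M \<phi>" and K: "compact K" "K \<subseteq> M" "\<And>x. x \<in> M - K \<Longrightarrow> \<phi> x = 0"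
    using \<phi> by (auto simp: test_on_def)
  define f where "f x = (if x \<in> M then \<phi> x else 0)" for x
  define f' where "f' x = (if x \<in> M then frechet_derivative \<phi> (at x) else (\<lambda>_. 0))" for x
  have "open (- K)"
    using K(1) by (simp add: compact_imp_closed open_Compl)
  have f_K: "f x = 0" if "x \<notin> K" for x
    using that K(3) by (auto simp: f_def)
  have der0: "(f has_derivative (\<lambda>_. 0)) (at x)" if "x \<notin> K" for x
    by (rule has_derivative_transform_within_open[OF has_derivative_const[of 0] \<open>open (- K)\<close>])
       (use that f_K in auto)
  have derM: "(f has_derivative frechet_derivative \<phi> (at x)) (at x)" if "x \<in> M" for x
    by (rule has_derivative_transform_within_open[OF smooth_on_has_derivative[OF smooth that] M that])
       (auto simp: f_def)
  have der: "(f has_derivative f' x) (at x)" for x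
    using der0[of x] derM[of x] K(2) by (auto simp: f'_def)
  have f'_K: "f' x v = 0" if "x \<notin> K" for x
    using has_derivative_unique[OF der der0[OF that]] by simp
  have "continuous_on (M \<union> - K) (\<lambda>x. f' x v)"
  proof (rule continuous_on_open_Un[OF M \<open>open (- K)\<close>])
    show "continuous_on M (\<lambda>x. f' x v)"
      using smooth_on_imp_continuous_on[OF smooth_on_frechet_derivative[OF smooth]]
      by (rule continuous_on_eq) (simp add: f'_def)
    show "continuous_on (- K) (\<lambda>x. f' x v)"
      using f'_K by (intro continuous_on_eq[OF continuous_on_const[of _ 0]]) auto
  qed
  moreover have "M \<union> - K = UNIV"
    using K(2) by auto
  ultimately have "(LINT x|lborel. f' x v) = 0"
    using der K(1) f_K f'_K by (intro integral_directional_derivative_eq_0[of f f' v K]) auto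
  moreover have "(LINT x:M|lborel. frechet_derivative \<phi> (at x) v) = (LINT x|lborel. f' x v)"
    unfolding set_lebesgue_integral_def
    by (rule Bochner_Integration.integral_cong) (auto simp: f'_def indicator_def)
  ultimately show ?thesis by simp
qed

section \<open>The hyperbolic disk as a conformal metric\<close>

definition conf :: "real \<Rightarrow> real ^ 2 \<Rightarrow> real" where
  "conf a x = 4 / (a\<^sup>2 * (1 - (norm x)\<^sup>2)\<^sup>2)"

lemma hyp_metric_conf: "hyp_metric a x = mat (conf a x)"
  by (simp add: hyp_metric_def conf_def)

lemma hyp_metric_nth: "hyp_metric a x $ i $ j = (if i = j then conf a x else 0)"
  by (simp add: hyp_metric_conf mat_def)

lemma open_hyp_disk: "open hyp_disk"
  by (simp add: hyp_disk_def)

lemma in_hyp_disk: "x \<in> hyp_disk \<Longrightarrow> 0 < 1 - (norm x)\<^sup>2"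
  by (simp add: hyp_disk_def power_less_one_iff)

lemma conf_nonneg: "0 \<le> conf a x"
  by (simp add: conf_def)

lemma conf_pos: "a > 0 \<Longrightarrow> x \<in> hyp_disk \<Longrightarrow> 0 < conf a x"
  using in_hyp_disk[of x] by (simp add: conf_def zero_less_mult_iff)

lemma continuous_on_conf: "a > 0 \<Longrightarrow> continuous_on hyp_disk (conf a)"
proof -
  assume "a > 0"
  moreover have "(norm x)\<^sup>2 \<noteq> 1" if "x \<in> hyp_disk" for x
    using in_hyp_disk[OF that] by simp
  ultimately show ?thesis
    unfolding conf_def[abs_def] by (intro continuous_intros) auto
qed

lemma borel_measurable_conf: "conf a \<in> borel_measurable borel"
  unfolding conf_def[abs_def] by measurable

lemma sqrt_det_hyp_metric: "sqrt (det (hyp_metric a x)) = conf a x"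
  using conf_nonneg[of a x] by (simp add: det_2 hyp_metric_nth)

lemma ginv_hyp_metric:
  assumes "a > 0" "x \<in> hyp_disk"
  shows "ginv (hyp_metric a) x $ i $ j = (if i = j then 1 / conf a x else 0)"
proof -
  have "hyp_metric a x ** mat (1 / conf a x) = mat 1" "mat (1 / conf a x) ** hyp_metric a x = mat 1"
    using conf_pos[OF assms]
    by (simp_all add: matrix_matrix_mult_def vec_eq_iff mat_def hyp_metric_nth forall_2 sum_2)
  then have "ginv (hyp_metric a) x = mat (1 / conf a x)"
    unfolding ginv_def matrix_inv_def
    by (intro some_equality) (auto, metis matrix_mul_assoc matrix_mul_lid matrix_mul_rid)
  then show ?thesis by (simp add: mat_def)
qed

lemma inner1_hyp:
  assumes "a > 0" "x \<in> hyp_disk"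
  shows "inner1 (hyp_metric a) x \<alpha> \<beta> = (\<alpha> \<bullet> \<beta>) / conf a x"
  by (simp add: inner1_def ginv_hyp_metric[OF assms] sum_2 inner_vec_def add_divide_distrib)

lemma inner2_hyp:
  assumes "a > 0" "x \<in> hyp_disk"
  shows "inner2 (hyp_metric a) x A B = (\<Sum>i\<in>UNIV. \<Sum>j\<in>UNIV. A $ i $ j * B $ i $ j) / (conf a x)\<^sup>2"
  by (simp add: inner2_def ginv_hyp_metric[OF assms] sum_2 add_divide_distrib power2_eq_square)

lemma integral_vol_hyp:
  fixes f :: "real ^ 2 \<Rightarrow> real"
  assumes "continuous_on hyp_disk f"
  shows "(LINT x|vol hyp_disk (hyp_metric a). f x) = (LINT x:hyp_disk|lborel. conf a x * f x)"
proof -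
  have disk: "hyp_disk \<inter> space lborel \<in> sets lborel"
    by (simp add: hyp_disk_def)
  have f: "f \<in> borel_measurable (restrict_space lborel hyp_disk)"
    using borel_measurable_continuous_on_restrict[OF assms]
    by (subst measurable_cong_sets[OF sets_restrict_space_cong[OF sets_lborel] refl])
  have c: "conf a \<in> borel_measurable (restrict_space lborel hyp_disk)"
    using borel_measurable_conf by (intro measurable_restrict_space1) simp
  show ?thesis
    unfolding vol_def sqrt_det_hyp_metric
    by (subst integral_density[OF f c]) (auto simp: conf_nonneg integral_restrict_space[OF disk]
        set_lebesgue_integral_def)
qed

lemma nn_integral_vol_hyp:
  "(\<integral>\<^sup>+x. f x \<partial>vol hyp_disk (hyp_metric a))
     = (\<integral>\<^sup>+x\<in>hyp_disk. ennreal (conf a x) * f x \<partial>lborel)"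
  if "f \<in> borel_measurable (restrict_space lborel hyp_disk)"
proof -
  have disk: "hyp_disk \<inter> space lborel \<in> sets lborel"
    by (simp add: hyp_disk_def)
  have "(\<lambda>x. ennreal (conf a x)) \<in> borel_measurable (restrict_space lborel hyp_disk)"
    using borel_measurable_conf by (intro measurable_restrict_space1) simp
  then show ?thesis
    unfolding vol_def sqrt_det_hyp_metric
    by (subst nn_integral_density[OF _ that]) (auto simp: nn_integral_restrict_space[OF disk])
qed

section \<open>Constant one-forms are harmonic\<close>

lemma inner_d0:
  assumes "smooth_on M \<phi>" "x \<in> M"
  shows "w \<bullet> d0 \<phi> x = frechet_derivative \<phi> (at x) (w :: real ^ 'n::finite)"
proof -
  have lin: "linear (frechet_derivative \<phi> (at x))"
    using smooth_on_has_derivative[OF assms] by (rule has_derivative_linear)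
  have "frechet_derivative \<phi> (at x) w = frechet_derivative \<phi> (at x) (\<Sum>i\<in>UNIV. w $ i *\<^sub>R axis i 1)"
    by (simp add: basis_expansion flip: scalar_mult_eq_scaleR)
  also have "\<dots> = (\<Sum>i\<in>UNIV. w $ i *\<^sub>R frechet_derivative \<phi> (at x) (axis i 1))"
    by (simp add: linear_sum[OF lin] linear_cmul[OF lin])
  finally show ?thesis
    by (simp add: inner_vec_def d0_def pd_def)
qed

text \<open>
  The conformal factors of the volume and of the inner product of one-forms cancel in dimension two,
  which leaves the Euclidean integral of a directional derivative.
\<close>
lemma adjoint_d0_const:
  assumes "a > 0"
  shows "adjoint_d0 hyp_disk (hyp_metric a) (\<lambda>_. w) (\<lambda>_. 0)"
  unfolding adjoint_d0_def
proof (intro allI impI)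
  fix \<phi> :: "real ^ 2 \<Rightarrow> real"
  assume \<phi>: "test_on hyp_disk \<phi>"
  then have smooth: "smooth_on hyp_disk \<phi>"
    by (simp add: test_on_def)
  have eq: "inner1 (hyp_metric a) x w (d0 \<phi> x) = frechet_derivative \<phi> (at x) w / conf a x"
    if "x \<in> hyp_disk" for x
    using that by (simp add: inner1_hyp[OF assms] inner_d0[OF smooth])
  have "continuous_on hyp_disk (\<lambda>x. frechet_derivative \<phi> (at x) w / conf a x)"
    using conf_pos[OF assms]
    by (intro continuous_on_divide continuous_on_conf assms
        smooth_on_imp_continuous_on smooth_on_frechet_derivative smooth) force
  then have cont: "continuous_on hyp_disk (\<lambda>x. inner1 (hyp_metric a) x w (d0 \<phi> x))"
    by (rule continuous_on_eq) (simp add: eq)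
  have "(LINT x|vol hyp_disk (hyp_metric a). inner1 (hyp_metric a) x w (d0 \<phi> x))
      = (LINT x:hyp_disk|lborel. frechet_derivative \<phi> (at x) w)"
    unfolding integral_vol_hyp[OF cont] set_lebesgue_integral_def
    by (rule Bochner_Integration.integral_cong)
       (use conf_pos[OF assms] in \<open>force simp: eq indicator_def\<close>)+
  also have "\<dots> = 0"
    by (rule integral_derivative_test_function[OF open_hyp_disk \<phi>])
  finally show "(LINT x|vol hyp_disk (hyp_metric a). 0 * \<phi> x)
      = (LINT x|vol hyp_disk (hyp_metric a). inner1 (hyp_metric a) x w (d0 \<phi> x))"
    by simp
qed

lemma dstar1_const:
  assumes "a > 0" "x \<in> hyp_disk"
  shows "dstar1 hyp_disk (hyp_metric a) (\<lambda>_. w) x = 0"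
  unfolding dstar1_def
proof (rule the_equality)
  show "\<exists>h. smooth_on hyp_disk h \<and> adjoint_d0 hyp_disk (hyp_metric a) (\<lambda>_. w) h \<and> h x = 0"
    using adjoint_d0_const[OF assms(1)] by (intro exI[of _ "\<lambda>_. 0"]) (auto simp: smooth_on_const)
next
  fix c
  assume "\<exists>h. smooth_on hyp_disk h \<and> adjoint_d0 hyp_disk (hyp_metric a) (\<lambda>_. w) h \<and> h x = c"
  then obtain h where h: "smooth_on hyp_disk h" "adjoint_d0 hyp_disk (hyp_metric a) (\<lambda>_. w) h" "h x = c"
    by blast
  have "conf a x * h x = 0"
  proof (rule eq_0_if_test_integrals_0[OF open_hyp_disk _ _ assms(2)])
    show "continuous_on hyp_disk (\<lambda>x. conf a x * h x)"
      by (intro continuous_intros continuous_on_conf assms smooth_on_imp_continuous_on h)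
    fix \<phi> :: "real ^ 2 \<Rightarrow> real"
    assume \<phi>: "test_on hyp_disk \<phi>"
    have "continuous_on hyp_disk (\<lambda>x. h x * \<phi> x)"
      using \<phi> by (intro continuous_intros smooth_on_imp_continuous_on h) (simp add: test_on_def)
    from integral_vol_hyp[OF this, of a]
    have "(LINT x:hyp_disk|lborel. conf a x * h x * \<phi> x)
        = (LINT x|vol hyp_disk (hyp_metric a). h x * \<phi> x)"
      by (simp add: mult.assoc)
    also have "\<dots> = 0"
      using h(2) adjoint_d0_const[OF assms(1), of w] \<phi> by (simp add: adjoint_d0_def)
    finally show "(LINT x:hyp_disk|lborel. conf a x * h x * \<phi> x) = 0" .
  qed
  then show "c = 0"
    using conf_pos[OF assms] h(3) by simp
qed

text \<open>
  The zero form is the only continuous form orthogonal to all test forms: tests of the shape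
  \<open>\<phi> dx\<^sup>i\<close> isolate one component at a time.
\<close>
lemma dstar2_0:
  assumes "a > 0" "x \<in> hyp_disk"
  shows "dstar2 hyp_disk (hyp_metric a) (\<lambda>_. 0) x = 0"
  unfolding dstar2_def
proof (rule the_equality)
  show "\<exists>\<beta>. smooth_on hyp_disk \<beta> \<and> adjoint_d1 hyp_disk (hyp_metric a) (\<lambda>_. 0) \<beta> \<and> \<beta> x = 0"
    by (intro exI[of _ "\<lambda>_. 0"])
       (auto simp: smooth_on_const adjoint_d1_def inner1_def inner_2form_def inner2_def)
next
  fix c
  assume "\<exists>\<beta>. smooth_on hyp_disk \<beta> \<and> adjoint_d1 hyp_disk (hyp_metric a) (\<lambda>_. 0) \<beta> \<and> \<beta> x = c"
  then obtain \<beta> where \<beta>: "smooth_on hyp_disk \<beta>" "adjoint_d1 hyp_disk (hyp_metric a) (\<lambda>_. 0) \<beta>" "\<beta> x = c"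
    by blast
  have cont: "continuous_on hyp_disk (\<lambda>x. \<beta> x $ i)" for i
    by (intro continuous_intros smooth_on_imp_continuous_on \<beta>)
  have "\<beta> x $ i = 0" for i
  proof (rule eq_0_if_test_integrals_0[OF open_hyp_disk cont _ assms(2)])
    fix \<phi> :: "real ^ 2 \<Rightarrow> real"
    assume \<phi>: "test_on hyp_disk \<phi>"
    let ?\<Phi> = "\<lambda>x. \<phi> x *\<^sub>R axis i 1 :: real ^ 2"
    have \<Phi>: "test_on hyp_disk ?\<Phi>"
      using \<phi> by (auto simp: test_on_def intro!: smooth_on_scaleR smooth_on_const open_hyp_disk)
    have eq: "inner1 (hyp_metric a) x (\<beta> x) (?\<Phi> x) = \<beta> x $ i * \<phi> x / conf a x"
      if "x \<in> hyp_disk" for x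
      using that by (simp add: inner1_hyp[OF assms(1)] inner_axis mult.commute)
    have "continuous_on hyp_disk (\<lambda>x. \<beta> x $ i * \<phi> x / conf a x)"
      using conf_pos[OF assms(1)] \<phi> cont[of i]
      by (intro continuous_on_divide continuous_on_mult continuous_on_conf assms)
         (force simp: test_on_def intro: smooth_on_imp_continuous_on)+
    then have cont': "continuous_on hyp_disk (\<lambda>x. inner1 (hyp_metric a) x (\<beta> x) (?\<Phi> x))"
      by (rule continuous_on_eq) (simp only: eq)
    have "(LINT x:hyp_disk|lborel. \<beta> x $ i * \<phi> x)
        = (LINT x|vol hyp_disk (hyp_metric a). inner1 (hyp_metric a) x (\<beta> x) (?\<Phi> x))"
      unfolding integral_vol_hyp[OF cont'] set_lebesgue_integral_def
      by (rule Bochner_Integration.integral_cong)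
         (use conf_pos[OF assms(1)] in \<open>force simp: eq indicator_def\<close>)+
    also have "\<dots> = 0"
      using \<beta>(2) \<Phi> by (simp add: adjoint_d1_def inner_2form_def inner2_def)
    finally show "(LINT x:hyp_disk|lborel. \<beta> x $ i * \<phi> x) = 0" .
  qed
  then show "c = 0"
    using \<beta>(3) by (simp add: vec_eq_iff)
qed

lemma pd_cong:
  assumes "open S" "x \<in> S" "\<And>y. y \<in> S \<Longrightarrow> f y = g y"
  shows "pd i f x = pd i g x"
proof -
  have "(f has_derivative D) (at x) \<longleftrightarrow> (g has_derivative D) (at x)" for D
    using assms by (metis has_derivative_transform_within_open)
  then show ?thesis by (simp add: pd_def frechet_derivative_def)
qed

lemma pd_eqI: "(f has_derivative f') (at x) \<Longrightarrow> pd i f x = f' (axis i 1)"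
  unfolding pd_def by (metis frechet_derivative_at)

lemma pd_const: "pd i (\<lambda>_. c) x = 0"
  by (simp add: pd_def frechet_derivative_const)

lemma hodge_Laplacian_const:
  assumes "a > 0" "x \<in> hyp_disk"
  shows "hodge_Laplacian hyp_disk (hyp_metric a) (\<lambda>_. w) x = 0"
proof -
  have "d0 (dstar1 hyp_disk (hyp_metric a) (\<lambda>_. w)) x = 0"
    using pd_cong[OF open_hyp_disk assms(2) dstar1_const[OF assms(1), of _ w]]
    by (simp add: d0_def vec_eq_iff pd_const)
  moreover have "d1 (\<lambda>_. w) = (\<lambda>_. 0)"
    by (simp add: fun_eq_iff d1_def vec_eq_iff pd_const)
  ultimately show ?thesis
    by (simp add: hodge_Laplacian_def dstar2_0[OF assms])
qed

section \<open>Connection and curvature of the hyperbolic disk\<close>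

text \<open>
  The logarithmic derivatives \<open>\<mu>\<^sub>i = \<partial>\<^sub>i (log (conf a)) / 2\<close>, through which the Christoffel symbols of a
  conformally flat metric are expressed.  They do not depend on \<open>a\<close>.
\<close>
definition mu :: "2 \<Rightarrow> real ^ 2 \<Rightarrow> real" where
  "mu i x = 2 * x $ i / (1 - (norm x)\<^sup>2)"

lemma mu_squares: "(mu 1 x)\<^sup>2 + (mu 2 x)\<^sup>2 = 4 * (norm x)\<^sup>2 / (1 - (norm x)\<^sup>2)\<^sup>2"
proof -
  have "(2 * x $ 1 / s)\<^sup>2 + (2 * x $ 2 / s)\<^sup>2 = 4 * (norm x)\<^sup>2 / s\<^sup>2" for s
    unfolding power2_norm_eq_inner inner_vec_def sum_2
    by (simp add: power2_eq_square add_divide_distrib distrib_left)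
  then show ?thesis by (simp add: mu_def)
qed

lemma has_derivative_one_minus_norm2:
  "((\<lambda>x. 1 - (norm x)\<^sup>2) has_derivative (\<lambda>h. - 2 * (x \<bullet> h))) (at x)"
  unfolding power2_norm_eq_inner
  by (auto intro!: derivative_eq_intros simp: inner_commute)

lemma pd_conf:
  assumes "a > 0" "x \<in> hyp_disk"
  shows "pd i (conf a) x = 2 * conf a x * mu i x"
proof -
  define s where "s = 1 - (norm x)\<^sup>2"
  have s: "0 < s"
    using in_hyp_disk[OF assms(2)] by (simp add: s_def)
  have "((\<lambda>t. 4 / (a\<^sup>2 * t\<^sup>2)) has_real_derivative - 8 / (a\<^sup>2 * s ^ 3)) (at s)"
    using s assms(1)
    by (auto intro!: derivative_eq_intros simp: field_simps power2_eq_square power3_eq_cube)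
  from DERIV_compose_FDERIV[OF this[unfolded s_def] has_derivative_one_minus_norm2]
  have "(conf a has_derivative (\<lambda>h. - 2 * (x \<bullet> h) * (- 8 / (a\<^sup>2 * s ^ 3)))) (at x)"
    by (simp add: conf_def[abs_def] s_def)
  from pd_eqI[OF this, of i] show ?thesis
    unfolding conf_def mu_def s_def[symmetric] using s assms(1)
    by (simp add: inner_axis field_simps power2_eq_square power3_eq_cube)
qed

lemma mu_has_derivative:
  assumes "x \<in> hyp_disk"
  shows "(mu i has_derivative (\<lambda>h. 2 * h $ i / (1 - (norm x)\<^sup>2) + mu i x * (2 * (x \<bullet> h) / (1 - (norm x)\<^sup>2)))) (at x)"
proof -
  define s where "s = 1 - (norm x)\<^sup>2"
  have s: "0 < s"
    using in_hyp_disk[OF assms] by (simp add: s_def)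
  have "((\<lambda>t. 1 / t) has_real_derivative - 1 / s\<^sup>2) (at s)"
    using s by (auto intro!: derivative_eq_intros simp: power2_eq_square)
  from DERIV_compose_FDERIV[OF this[unfolded s_def] has_derivative_one_minus_norm2]
  have inv: "((\<lambda>x. 1 / (1 - (norm x)\<^sup>2)) has_derivative (\<lambda>h. - 2 * (x \<bullet> h) * (- 1 / s\<^sup>2))) (at x)"
    by (simp add: s_def)
  have lin: "((\<lambda>x. 2 * x $ i) has_derivative (\<lambda>h. 2 * h $ i)) (at x)"
    by (intro has_derivative_mult_right bounded_linear_imp_has_derivative bounded_linear_vec_nth)
  have "(mu i has_derivative (\<lambda>h. 2 * x $ i * (- 2 * (x \<bullet> h) * (- 1 / s\<^sup>2))
      + 2 * h $ i * (1 / (1 - (norm x)\<^sup>2)))) (at x)"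
    using has_derivative_mult[OF lin inv] by (simp add: mu_def[abs_def])
  then show ?thesis
    unfolding mu_def s_def[symmetric]
    by (rule has_derivative_eq_rhs) (use s in \<open>simp add: fun_eq_iff field_simps power2_eq_square\<close>)
qed

lemma pd_mu:
  assumes "x \<in> hyp_disk"
  shows "pd j (mu i) x = (if i = j then 2 / (1 - (norm x)\<^sup>2) else 0) + mu i x * mu j x"
proof -
  have "pd j (mu i) x = 2 * axis j 1 $ i / (1 - (norm x)\<^sup>2) + mu i x * mu j x"
    using pd_eqI[OF mu_has_derivative[OF assms], of j] by (simp add: mu_def[of j] inner_axis)
  then show ?thesis by (simp add: axis_def)
qed

lemma christoffel_hyp:
  assumes "a > 0" "x \<in> hyp_disk"
  shows "christoffel (hyp_metric a) k i j x =
    (if j = k then mu i x else 0) + (if i = k then mu j x else 0) - (if i = j then mu k x else 0)"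
proof -
  have "pd m (\<lambda>y. hyp_metric a y $ p $ q) x = (if p = q then 2 * conf a x * mu m x else 0)" for m p q
    using pd_conf[OF assms, of m] by (simp add: hyp_metric_nth pd_const)
  then show ?thesis
    using conf_pos[OF assms] exhaust_2[of i] exhaust_2[of j] exhaust_2[of k]
    by (auto simp: christoffel_def ginv_hyp_metric[OF assms] sum_2 field_simps)
qed

lemma nabla_const:
  assumes "a > 0" "x \<in> hyp_disk"
  shows "nabla (hyp_metric a) (\<lambda>_. w) x $ i $ j =
    (if i = j then mu 1 x * w $ 1 + mu 2 x * w $ 2 else 0) - mu i x * w $ j - mu j x * w $ i"
  using exhaust_2[of i] exhaust_2[of j]
  by (auto simp: nabla_def pd_const christoffel_hyp[OF assms] sum_2)

text \<open>
  A closed form has a symmetric covariant derivative, so its deformation tensor is all of \<open>\<nabla>w\<close>.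
\<close>
lemma Def_tensor_const:
  assumes "a > 0" "x \<in> hyp_disk"
  shows "Def_tensor (hyp_metric a) (\<lambda>_. w) x = nabla (hyp_metric a) (\<lambda>_. w) x"
  by (simp add: vec_eq_iff Def_tensor_def nabla_const[OF assms])

text \<open>
  The right-hand side is the differential of \<open>|w|\<^sup>2 / 2\<close>, where
  \<open>|w|\<^sup>2 = a\<^sup>2 (1 - |x|\<^sup>2)\<^sup>2 (w \<bullet> w) / 4\<close> is the squared length of \<open>w\<close> for the hyperbolic metric.
\<close>
lemma nabla_along_const:
  assumes "a > 0" "x \<in> hyp_disk"
  shows "nabla_along (hyp_metric a) (sharp (hyp_metric a) (\<lambda>_. w)) (\<lambda>_. w) x
    = (- (w \<bullet> w) * a\<^sup>2 * (1 - x \<bullet> x) / 2) *\<^sub>R x"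
proof -
  have pos: "0 < 1 - x \<bullet> x"
    using in_hyp_disk[OF assms(2)] by (simp add: power2_norm_eq_inner)
  have sharp: "sharp (hyp_metric a) (\<lambda>_. w) x $ i = w $ i / conf a x" for i
    using exhaust_2[of i]
    by (auto simp: sharp_def matrix_vector_mult_def ginv_hyp_metric[OF assms] sum_2)
  have "nabla_along (hyp_metric a) (sharp (hyp_metric a) (\<lambda>_. w)) (\<lambda>_. w) x $ j
      = - (w \<bullet> w) * (mu j x / conf a x)" for j
    using exhaust_2[of j]
    by (auto simp: nabla_along_def sharp nabla_const[OF assms] sum_2 inner_vec_def algebra_simps
        diff_divide_distrib add_divide_distrib)
  moreover have "mu j x / conf a x = a\<^sup>2 * (1 - x \<bullet> x) / 2 * x $ j" for j
  proof -
    define s where "s = 1 - x \<bullet> x"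
    show ?thesis
      unfolding mu_def conf_def power2_norm_eq_inner s_def[symmetric]
      using pos assms(1) by (simp add: s_def[symmetric] field_simps power2_eq_square)
  qed
  ultimately show ?thesis
    by (simp add: vec_eq_iff)
qed

text \<open>
  The contracted curvature is \<open>- \<kappa>\<close> times the identity with \<open>\<kappa> = \<partial>\<^sub>1\<mu>\<^sub>1 + \<partial>\<^sub>2\<mu>\<^sub>2\<close>, half the Euclidean
  Laplacian of \<open>log (conf a)\<close>; dividing it by the conformal factor gives the Gauss equation
  \<open>K = - \<Delta> log (conf a) / (2 conf a) = - a\<^sup>2\<close>.
\<close>
lemma Ric_hyp:
  assumes "a > 0" "x \<in> hyp_disk"
  shows "Ric (hyp_metric a) \<omega> x = (- a\<^sup>2) *\<^sub>R \<omega> x"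
proof -
  let ?G = "\<lambda>k i j. (\<lambda>x. (if j = k then mu i x else 0) + (if i = k then mu j x else 0)
      - (if i = j then mu k x else 0))"
  let ?s = "1 - (norm x)\<^sup>2"
  have s: "0 < ?s" by (rule in_hyp_disk[OF assms(2)])
  have pd_G: "pd m (christoffel (hyp_metric a) k i j) x =
      (if j = k then pd m (mu i) x else 0) + (if i = k then pd m (mu j) x else 0)
      - (if i = j then pd m (mu k) x else 0)" for m k i j
  proof -
    \<comment> \<open>The \<open>if\<close> terms come from Kronecker deltas: their conditions do not involve the point.\<close>
    have D: "((\<lambda>y. if b then mu l y else 0) has_derivative
        (\<lambda>h. if b then frechet_derivative (mu l) (at x) h else 0)) (at x)" for b l
      using mu_has_derivative[OF assms(2), of l]
        frechet_derivative_at[OF mu_has_derivative[OF assms(2), of l], symmetric]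
      by (cases b) auto
    have "pd m (christoffel (hyp_metric a) k i j) x = pd m (?G k i j) x"
      by (rule pd_cong[OF open_hyp_disk assms(2)]) (rule christoffel_hyp[OF assms(1)])
    also have "(?G k i j has_derivative (\<lambda>h.
        (if j = k then frechet_derivative (mu i) (at x) h else 0)
        + (if i = k then frechet_derivative (mu j) (at x) h else 0)
        - (if i = j then frechet_derivative (mu k) (at x) h else 0))) (at x)"
      by (intro has_derivative_add has_derivative_diff D)
    from pd_eqI[OF this, of m] have "pd m (?G k i j) x =
      (if j = k then pd m (mu i) x else 0) + (if i = k then pd m (mu j) x else 0)
      - (if i = j then pd m (mu k) x else 0)"
      by (simp add: pd_def)
    finally show ?thesis .
  qed
  define \<kappa> where "\<kappa> = 4 / ?s + (mu 1 x)\<^sup>2 + (mu 2 x)\<^sup>2"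
  have \<kappa>: "\<kappa> / conf a x = a\<^sup>2"
  proof -
    define s where "s = ?s"
    have "0 < s"
      using s by (simp only: s_def)
    have "4 / s + (mu 1 x)\<^sup>2 + (mu 2 x)\<^sup>2 = 4 / s + 4 * (1 - s) / s\<^sup>2"
      using mu_squares[of x] by (simp add: s_def)
    also have "\<dots> / (4 / (a\<^sup>2 * s\<^sup>2)) = a\<^sup>2"
      using \<open>0 < s\<close> assms(1) by (simp add: field_simps power2_eq_square)
    finally show ?thesis
      by (simp add: \<kappa>_def conf_def s_def)
  qed
  have curv: "(\<Sum>j\<in>UNIV. curvature (hyp_metric a) m j i j x)
      = (if i = m then - \<kappa> else 0)" for m i
    using exhaust_2[of m] exhaust_2[of i]
    by (auto simp: \<kappa>_def curvature_def pd_G christoffel_hyp[OF assms] pd_mu[OF assms(2)] sum_2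
        power2_eq_square algebra_simps)
  have "Ric (hyp_metric a) \<omega> x $ i = (\<Sum>m\<in>UNIV. (\<Sum>j\<in>UNIV. curvature (hyp_metric a) m j i j x) * \<omega> x $ m) / conf a x" for i
    by (simp add: Ric_def ginv_hyp_metric[OF assms] sum_2 algebra_simps add_divide_distrib)
  also have "\<dots> i = - (\<kappa> / conf a x) * \<omega> x $ i" for i
    using exhaust_2[of i] by (auto simp: curv sum_2)
  finally show ?thesis
    by (simp add: vec_eq_iff \<kappa>)
qed

section \<open>Energies\<close>

lemma emeasure_hyp_disk: "emeasure lborel hyp_disk = ennreal (measure lborel hyp_disk)"
  using emeasure_bounded_finite[of "hyp_disk"]
  by (simp add: hyp_disk_def emeasure_eq_ennreal_measure)

lemma borel_measurable_on_disk:
  assumes "g \<in> borel_measurable borel" "\<And>x. x \<in> hyp_disk \<Longrightarrow> f x = g x"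
  shows "(\<lambda>x. ennreal (f x)) \<in> borel_measurable (restrict_space lborel hyp_disk)"
proof -
  have "(\<lambda>x. ennreal (g x)) \<in> borel_measurable (restrict_space lborel hyp_disk)"
    using assms(1) by (intro measurable_restrict_space1) simp
  then show ?thesis
    by (subst measurable_cong[where g = "\<lambda>x. ennreal (g x)"]) (auto simp: space_restrict_space assms(2))
qed

lemma L2sq1_const:
  assumes "a > 0"
  shows "L2sq1 hyp_disk (hyp_metric a) (\<lambda>_. w) = ennreal ((w \<bullet> w) * measure lborel hyp_disk)"
proof -
  have "(\<lambda>x. ennreal (inner1 (hyp_metric a) x w w)) \<in> borel_measurable (restrict_space lborel hyp_disk)"
    using borel_measurable_conf
    by (intro borel_measurable_on_disk[of "\<lambda>x. (w \<bullet> w) / conf a x"]) (auto simp: inner1_hyp[OF assms])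
  then have "L2sq1 hyp_disk (hyp_metric a) (\<lambda>_. w)
      = (\<integral>\<^sup>+x\<in>hyp_disk. ennreal (conf a x) * ennreal (inner1 (hyp_metric a) x w w) \<partial>lborel)"
    unfolding L2sq1_def by (rule nn_integral_vol_hyp)
  also have "\<dots> = (\<integral>\<^sup>+x\<in>hyp_disk. ennreal (w \<bullet> w) \<partial>lborel)"
    using conf_pos[OF assms]
    by (intro nn_integral_cong) (force simp: indicator_def inner1_hyp[OF assms] simp flip: ennreal_mult)
  also have "\<dots> = ennreal (w \<bullet> w) * emeasure lborel hyp_disk"
    by (simp add: nn_integral_cmult_indicator hyp_disk_def)
  finally show ?thesis by (simp add: emeasure_hyp_disk ennreal_mult)
qed

text \<open>
  In the chart the energy density of \<open>\<nabla>w\<close> times the volume density is \<open>2 a\<^sup>2 |x|\<^sup>2 (w \<bullet> w)\<close>, and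
  \<open>|x| \<le> 1\<close>.  The form of the statement, with \<open>A\<close> equal to \<open>\<nabla>w\<close> on the disk only, covers the
  deformation tensor as well.
\<close>
lemma L2sq2_nabla_const_le:
  assumes "a > 0" "\<And>x. x \<in> hyp_disk \<Longrightarrow> A x = nabla (hyp_metric a) (\<lambda>_. w) x"
  shows "L2sq2 hyp_disk (hyp_metric a) A \<le> ennreal (2 * a\<^sup>2 * ((w \<bullet> w) * measure lborel hyp_disk))"
proof -
  let ?g = "\<lambda>x. 8 * (x \<bullet> x) * (w \<bullet> w) / (1 - x \<bullet> x)\<^sup>2 / (conf a x)\<^sup>2"
  have eq: "inner2 (hyp_metric a) x (A x) (A x) = ?g x" if "x \<in> hyp_disk" for x
  proof -
    have "inner2 (hyp_metric a) x (A x) (A x)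
        = 2 * ((mu 1 x)\<^sup>2 + (mu 2 x)\<^sup>2) * (w \<bullet> w) / (conf a x)\<^sup>2"
      by (simp add: assms(2)[OF that] inner2_hyp[OF assms(1) that] nabla_const[OF assms(1) that] sum_2
          inner_vec_def power2_eq_square algebra_simps)
    also have "(mu 1 x)\<^sup>2 + (mu 2 x)\<^sup>2 = 4 * (x \<bullet> x) / (1 - x \<bullet> x)\<^sup>2"
      by (simp add: mu_squares power2_norm_eq_inner)
    finally show ?thesis by simp
  qed
  have "(\<lambda>x. ennreal (inner2 (hyp_metric a) x (A x) (A x))) \<in> borel_measurable (restrict_space lborel hyp_disk)"
  proof (rule borel_measurable_on_disk[OF _ eq])
    show "?g \<in> borel_measurable borel"
      using borel_measurable_conf[of a] by measurable
  qed
  then have "L2sq2 hyp_disk (hyp_metric a) A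
      = (\<integral>\<^sup>+x\<in>hyp_disk. ennreal (conf a x) * ennreal (inner2 (hyp_metric a) x (A x) (A x)) \<partial>lborel)"
    unfolding L2sq2_def by (rule nn_integral_vol_hyp)
  also have "\<dots> \<le> (\<integral>\<^sup>+x\<in>hyp_disk. ennreal (2 * a\<^sup>2 * (w \<bullet> w)) \<partial>lborel)"
  proof (intro nn_integral_mono)
    fix x
    have "conf a x * ?g x \<le> 2 * a\<^sup>2 * (w \<bullet> w)" if "x \<in> hyp_disk"
    proof -
      have pos: "0 < 1 - x \<bullet> x"
        using in_hyp_disk[OF that] by (simp add: power2_norm_eq_inner)
      have "conf a x * ?g x = 2 * a\<^sup>2 * (w \<bullet> w) * (x \<bullet> x)"
      proof -
        define s where "s = 1 - x \<bullet> x"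
        show ?thesis
          unfolding conf_def power2_norm_eq_inner s_def[symmetric]
          using pos assms(1) by (simp add: s_def[symmetric] field_simps power2_eq_square)
      qed
      also have "\<dots> \<le> 2 * a\<^sup>2 * (w \<bullet> w) * 1"
        using pos by (intro mult_left_mono) auto
      finally show ?thesis by simp
    qed
    then show "ennreal (conf a x) * ennreal (inner2 (hyp_metric a) x (A x) (A x)) * indicator hyp_disk x
        \<le> ennreal (2 * a\<^sup>2 * (w \<bullet> w)) * indicator hyp_disk x"
      by (auto simp: indicator_def eq conf_nonneg ennreal_mult[symmetric] intro!: ennreal_leI)
  qed
  also have "\<dots> = ennreal (2 * a\<^sup>2 * (w \<bullet> w)) * emeasure lborel hyp_disk"
    by (simp add: nn_integral_cmult_indicator hyp_disk_def)
  finally show ?thesis by (simp add: emeasure_hyp_disk ennreal_mult mult.assoc)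
qed

section \<open>Decaying harmonic flows\<close>

definition decay :: "real \<Rightarrow> 'a::real_normed_vector \<Rightarrow> real \<Rightarrow> 'b \<Rightarrow> 'a" where
  "decay c v t x = exp (- c * t) *\<^sub>R v"

lemma decay_const_form: "decay c v t = (\<lambda>_. exp (- c * t) *\<^sub>R v)"
  by (simp add: fun_eq_iff decay_def)

lemma smooth_on_decay:
  fixes S :: "(real \<times> 'a::real_normed_vector) set"
  assumes "open S"
  shows "smooth_on S (\<lambda>z. exp (- c * fst z))"
proof -
  have "smooth_on S (\<lambda>z. - c * fst z)"
    by (intro smooth_on_bounded_linear assms bounded_linear_intros)
  from smooth_on_compose_real[OF assms smooth_on_exp this] show ?thesis .
qed

text \<open>
  Any rate \<open>c\<close> is possible.  The pressure is
  \<open>P = (c - 2 a\<^sup>2) \<psi> (v \<bullet> x) - \<psi>\<^sup>2 |v|\<^sup>2 / 2\<close> with \<open>\<psi> = exp (- c t)\<close> and the hyperbolic length of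
  \<open>v\<close>: the first part balances the time derivative and the Ricci term, the second one the convection.
\<close>
lemma NS_solution_decay:
  fixes v :: "real ^ 2"
  assumes "a > 0"
  shows "NS_solution hyp_disk (hyp_metric a) (decay c v)"
proof -
  let ?g = "hyp_metric a"
  let ?S = "{0<..} \<times> hyp_disk :: (real \<times> (real ^ 2)) set"
  have S: "open ?S"
    by (intro open_Times open_hyp_disk) auto
  \<comment> \<open>Products instead of powers and subtractions, to match the closure rules of \<open>smooth_on\<close>.\<close>
  define P where "P t x = (c - 2 * a\<^sup>2) * (exp (- c * t) * (v \<bullet> x))
      + (exp (- c * t) * exp (- c * t)) * (- ((v \<bullet> v) * a\<^sup>2 / 8) * ((1 + - 1 * (x \<bullet> x)) * (1 + - 1 * (x \<bullet> x))))"
    for t and x :: "real ^ 2"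
  have "smooth_on ?S (\<lambda>z. decay c v (fst z) (snd z))"
    unfolding decay_def by (intro smooth_on_scaleR smooth_on_decay smooth_on_const S)
  moreover have "smooth_on ?S (\<lambda>z. P (fst z) (snd z))"
  proof -
    have "smooth_on ?S (\<lambda>z. snd z)"
      by (intro smooth_on_bounded_linear S bounded_linear_snd)
    then show ?thesis
      unfolding P_def
      by (intro smooth_on_add smooth_on_mult smooth_on_inner smooth_on_decay smooth_on_const S)
  qed
  moreover have "vector_derivative (\<lambda>s. decay c v s x) (at t) - hodge_Laplacian hyp_disk ?g (decay c v t) x
      + nabla_along ?g (sharp ?g (decay c v t)) (decay c v t) x - 2 *\<^sub>R Ric ?g (decay c v t) x
      + d0 (P t) x = 0" if x: "x \<in> hyp_disk" for t x
  proof -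
    let ?e = "exp (- c * t)"
    have "((\<lambda>s. decay c v s x) has_vector_derivative (- c * ?e) *\<^sub>R v) (at t)"
      unfolding decay_def by (auto intro!: derivative_eq_intros)
    then have time: "vector_derivative (\<lambda>s. decay c v s x) (at t) = (- c * ?e) *\<^sub>R v"
      by (rule vector_derivative_at)
    have "(P t has_derivative (\<lambda>h. (c - 2 * a\<^sup>2) * ?e * (v \<bullet> h)
        + ?e * ?e * (v \<bullet> v) * a\<^sup>2 / 2 * (1 - x \<bullet> x) * (x \<bullet> h))) (at x)"
      unfolding P_def[abs_def]
      by (auto intro!: derivative_eq_intros simp: fun_eq_iff inner_commute field_simps)
    from pd_eqI[OF this] have pressure: "d0 (P t) x = ((c - 2 * a\<^sup>2) * ?e) *\<^sub>R v
        + (?e * ?e * (v \<bullet> v) * a\<^sup>2 / 2 * (1 - x \<bullet> x)) *\<^sub>R x"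
      by (simp add: d0_def vec_eq_iff inner_axis)
    show ?thesis
      unfolding time
      unfolding pressure decay_const_form hodge_Laplacian_const[OF assms x]
        nabla_along_const[OF assms x] Ric_hyp[OF assms x]
      by (simp add: vec_eq_iff field_simps)
  qed
  moreover have "dstar1 hyp_disk ?g (decay c v t) x = 0" if "x \<in> hyp_disk" for t x
    unfolding decay_const_form by (rule dstar1_const[OF assms that])
  ultimately show ?thesis
    unfolding NS_solution_def case_prod_beta by (intro conjI exI[of _ P]) auto
qed

lemma nn_integral_exp_Ioo_le:
  fixes k c t :: real
  assumes "0 \<le> k" "0 < c" "0 \<le> t"
  shows "(\<integral>\<^sup>+s\<in>{0<..<t}. ennreal (k * exp (- c * s)) \<partial>lborel) \<le> ennreal (k / c * (1 - exp (- c * t)))"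
proof -
  have "(\<integral>\<^sup>+s\<in>{0<..<t}. ennreal (k * exp (- c * s)) \<partial>lborel)
      \<le> (\<integral>\<^sup>+s. ennreal (k * exp (- c * s)) * indicator {0..t} s \<partial>lborel)"
    by (intro nn_integral_mono) (auto simp: indicator_def)
  also have "\<dots> = ennreal (- (k / c) * exp (- c * t) - - (k / c) * exp (- c * 0))"
    by (rule nn_integral_FTC_Icc) (use assms in \<open>auto intro!: derivative_eq_intros
      simp: has_real_derivative_iff_has_vector_derivative[symmetric]\<close>)
  finally show ?thesis by (simp add: algebra_simps)
qed

lemma nn_integral_exp_half_line:
  fixes k c :: real
  assumes "0 \<le> k" "0 < c"
  shows "(\<integral>\<^sup>+s\<in>{0<..}. ennreal (k * exp (- c * s)) \<partial>lborel) < \<infinity>"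
proof -
  have "(\<integral>\<^sup>+s\<in>{0<..}. ennreal (k * exp (- c * s)) \<partial>lborel)
      \<le> (\<integral>\<^sup>+s. ennreal (k * exp (- c * s)) * indicator {0..} s \<partial>lborel)"
    by (intro nn_integral_mono) (auto simp: indicator_def)
  also have "\<dots> = ennreal (0 - - (k / c) * exp (- c * 0))"
  proof (rule nn_integral_FTC_atLeast)
    have "filterlim (\<lambda>s. - c * s) at_bot at_top"
      using assms by (intro filterlim_tendsto_neg_mult_at_bot[OF tendsto_const]) (auto intro: filterlim_ident)
    from filterlim_compose[OF exp_at_bot this]
    have "((\<lambda>s. exp (- c * s)) \<longlongrightarrow> 0) at_top" .
    from tendsto_mult_right_zero[OF this, of "- (k / c)"]
    show "((\<lambda>s. - (k / c) * exp (- c * s)) \<longlongrightarrow> 0) at_top" .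
  qed (use assms in \<open>auto intro!: derivative_eq_intros\<close>)
  also have "\<dots> < \<infinity>" by simp
  finally show ?thesis .
qed

text \<open>
  With \<open>E = \<parallel>v\<parallel>\<^sup>2\<close> the energy at time \<open>t\<close> is \<open>E exp (- 2 c t)\<close>, and the dissipation up to time \<open>t\<close> is at
  most \<open>(2 a\<^sup>2 / c) E (1 - exp (- 2 c t))\<close>.  The two add up to at most \<open>E\<close> as soon as \<open>2 a\<^sup>2 \<le> c\<close>.
\<close>
lemma Leray_Hopf_decay:
  fixes v :: "real ^ 2"
  assumes a: "a > 0" and c: "c \<ge> 2 * a\<^sup>2"
  shows "Leray_Hopf hyp_disk (hyp_metric a) (\<lambda>_. v) (decay c v)"
proof -
  let ?g = "hyp_metric a"
  define E where "E = (v \<bullet> v) * measure lborel hyp_disk"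
  have E: "0 \<le> E" by (simp add: E_def)
  have "0 < a\<^sup>2" using a by simp
  then have c0: "0 < c" using c by linarith
  have sq: "(exp (- c * t) *\<^sub>R v) \<bullet> (exp (- c * t) *\<^sub>R v) = (v \<bullet> v) * exp (- (2 * c) * t)" for t
    by (simp add: mult_ac flip: exp_add mult.assoc)
  have L2: "L2sq1 hyp_disk ?g (decay c v t) = ennreal (E * exp (- (2 * c) * t))" for t
    unfolding decay_const_form L2sq1_const[OF a] sq by (simp add: E_def mult_ac)
  have grad: "L2sq2 hyp_disk ?g A \<le> ennreal (2 * a\<^sup>2 * E * exp (- (2 * c) * t))"
    if "\<And>x. x \<in> hyp_disk \<Longrightarrow> A x = nabla ?g (decay c v t) x" for A t
  proof -
    have "2 * a\<^sup>2 * (((exp (- c * t) *\<^sub>R v) \<bullet> (exp (- c * t) *\<^sub>R v)) * measure lborel hyp_disk)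
        = 2 * a\<^sup>2 * E * exp (- (2 * c) * t)"
      unfolding sq by (simp add: E_def mult_ac)
    then show ?thesis
      using L2sq2_nabla_const_le[OF a that[unfolded decay_const_form]] by (simp only:)
  qed
  have "L2sq1 hyp_disk ?g (decay c v t) \<le> ennreal E" if "0 < t" for t
    unfolding L2 using that c0 E by (intro ennreal_leI) (simp add: mult_left_le)
  then have bounded: "\<exists>C::real. AE t in lborel. t > 0 \<longrightarrow> L2sq1 hyp_disk ?g (decay c v t) \<le> ennreal C"
    by (intro exI[of _ E]) auto
  have "(\<integral>\<^sup>+t\<in>{0<..}. H1sq hyp_disk ?g (decay c v t) \<partial>lborel)
      \<le> (\<integral>\<^sup>+t\<in>{0<..}. ennreal ((E + 2 * a\<^sup>2 * E) * exp (- (2 * c) * t)) \<partial>lborel)"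
  proof (intro nn_integral_mono mult_right_mono)
    fix t
    have "H1sq hyp_disk ?g (decay c v t)
        \<le> ennreal (E * exp (- (2 * c) * t)) + ennreal (2 * a\<^sup>2 * E * exp (- (2 * c) * t))"
      unfolding H1sq_def L2 by (intro add_left_mono grad) simp
    also have "\<dots> = ennreal ((E + 2 * a\<^sup>2 * E) * exp (- (2 * c) * t))"
      using E by (simp add: distrib_right flip: ennreal_plus)
    finally show "H1sq hyp_disk ?g (decay c v t) \<le> ennreal ((E + 2 * a\<^sup>2 * E) * exp (- (2 * c) * t))" .
  qed simp
  also have "\<dots> < \<infinity>"
    by (rule nn_integral_exp_half_line) (use E c0 in auto)
  finally have H1: "(\<integral>\<^sup>+t\<in>{0<..}. H1sq hyp_disk ?g (decay c v t) \<partial>lborel) < \<infinity>" .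
  have energy: "L2sq1 hyp_disk ?g (((decay c v)(0 := \<lambda>_. v)) t)
      + 2 * (\<integral>\<^sup>+s\<in>{0<..<t}. L2sq2 hyp_disk ?g (Def_tensor ?g (decay c v s)) \<partial>lborel)
      \<le> L2sq1 hyp_disk ?g (\<lambda>_. v)" if t: "t \<ge> 0" for t
  proof -
    have "((decay c v)(0 := \<lambda>_. v)) t = (decay c v t :: real ^ 2 \<Rightarrow> real ^ 2)"
      by (simp add: decay_const_form)
    then have "L2sq1 hyp_disk ?g (((decay c v)(0 := \<lambda>_. v)) t) = ennreal (E * exp (- (2 * c) * t))"
      by (simp only: L2)
    moreover have "(\<integral>\<^sup>+s\<in>{0<..<t}. L2sq2 hyp_disk ?g (Def_tensor ?g (decay c v s)) \<partial>lborel)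
        \<le> (\<integral>\<^sup>+s\<in>{0<..<t}. ennreal (2 * a\<^sup>2 * E * exp (- (2 * c) * s)) \<partial>lborel)"
      by (intro nn_integral_mono mult_right_mono grad)
         (simp_all add: decay_const_form Def_tensor_const[OF a])
    then have "2 * (\<integral>\<^sup>+s\<in>{0<..<t}. L2sq2 hyp_disk ?g (Def_tensor ?g (decay c v s)) \<partial>lborel)
        \<le> 2 * ennreal (2 * a\<^sup>2 * E / (2 * c) * (1 - exp (- (2 * c) * t)))"
      using nn_integral_exp_Ioo_le[of "2 * a\<^sup>2 * E" "2 * c" t] E c0 t
      by (intro mult_left_mono) (auto intro: order_trans)
    moreover have "2 * ennreal (2 * a\<^sup>2 * E / (2 * c) * (1 - exp (- (2 * c) * t)))
        \<le> ennreal (E * (1 - exp (- (2 * c) * t)))"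
    proof -
      have "2 * (2 * a\<^sup>2 * E / (2 * c)) \<le> E"
        using mult_right_mono[OF c E] c0 by (simp add: field_simps)
      then have "2 * (2 * a\<^sup>2 * E / (2 * c)) * (1 - exp (- (2 * c) * t)) \<le> E * (1 - exp (- (2 * c) * t))"
        using c0 t by (intro mult_right_mono) auto
      moreover have "2 * ennreal r = ennreal (2 * r)" for r
        by (metis ennreal_mult'' ennreal_numeral mult.commute zero_le_numeral)
      ultimately show ?thesis
        by (simp add: mult.assoc ennreal_leI)
    qed
    ultimately have "L2sq1 hyp_disk ?g (((decay c v)(0 := \<lambda>_. v)) t)
      + 2 * (\<integral>\<^sup>+s\<in>{0<..<t}. L2sq2 hyp_disk ?g (Def_tensor ?g (decay c v s)) \<partial>lborel)
      \<le> ennreal (E * exp (- (2 * c) * t)) + ennreal (E * (1 - exp (- (2 * c) * t)))"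
      by (intro add_mono) (simp_all only: order_refl order_trans)
    also have "\<dots> = ennreal E"
      using E c0 t by (subst ennreal_plus[symmetric]) (auto simp: right_diff_distrib intro!: mult_left_le)
    also have "\<dots> = L2sq1 hyp_disk ?g (\<lambda>_. v)"
      by (simp add: L2sq1_const[OF a] E_def)
    finally show ?thesis .
  qed
  have "L2sq1 hyp_disk ?g (\<lambda>x. decay c v t x - v) = ennreal ((exp (- c * t) - 1)\<^sup>2 * E)" for t
  proof -
    have "(\<lambda>x::real ^ 2. decay c v t x - v) = (\<lambda>_. (exp (- c * t) - 1) *\<^sub>R v)"
      by (simp add: fun_eq_iff decay_def scaleR_left_diff_distrib)
    then show ?thesis
      by (simp add: L2sq1_const[OF a] E_def power2_eq_square mult_ac)
  qed
  moreover have "((\<lambda>t. ennreal ((exp (- c * t) - 1)\<^sup>2 * E)) \<longlongrightarrow> ennreal ((exp (- c * 0) - 1)\<^sup>2 * E)) (at_right 0)"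
    by (intro tendsto_intros)
  ultimately have initial: "((\<lambda>t. L2sq1 hyp_disk ?g (\<lambda>x. decay c v t x - v)) \<longlongrightarrow> 0) (at_right 0)"
    by simp
  show ?thesis
    unfolding Leray_Hopf_def
    using NS_solution_decay[OF a] bounded H1 energy initial by blast
qed

theorem theorem1p2:
  fixes a :: real
  assumes "a > 0"
  shows "\<exists>u0 U1 U2.
           L2_form hyp_disk (hyp_metric a) u0 \<and>
           weakly_coclosed hyp_disk (hyp_metric a) u0 \<and>
           Leray_Hopf hyp_disk (hyp_metric a) u0 U1 \<and>
           Leray_Hopf hyp_disk (hyp_metric a) u0 U2 \<and>
           (\<exists>t>0. \<exists>x\<in>hyp_disk. U1 t x \<noteq> U2 t x)"
proof -
  define v :: "real ^ 2" where "v = axis 1 1"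
  have "v \<noteq> 0"
    by (simp add: v_def axis_eq_0_iff)
  have "L2_form hyp_disk (hyp_metric a) (\<lambda>_. v)"
    by (simp add: L2_form_def L2sq1_const[OF assms])
  moreover have "weakly_coclosed hyp_disk (hyp_metric a) (\<lambda>_. v)"
    unfolding weakly_coclosed_def by (rule adjoint_d0_const[OF assms])
  moreover have "Leray_Hopf hyp_disk (hyp_metric a) (\<lambda>_. v) (decay (2 * a\<^sup>2) v)"
    "Leray_Hopf hyp_disk (hyp_metric a) (\<lambda>_. v) (decay (3 * a\<^sup>2) v)"
    by (rule Leray_Hopf_decay[OF assms]; simp)+
  moreover have "decay (2 * a\<^sup>2) v 1 (0 :: real ^ 2) \<noteq> decay (3 * a\<^sup>2) v 1 0"
    using \<open>v \<noteq> 0\<close> assms by (simp add: decay_def)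
  moreover have "(0 :: real ^ 2) \<in> hyp_disk"
    by (simp add: hyp_disk_def)
  ultimately show ?thesis
    by (metis zero_less_one)
qed

end
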